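(* Let $n\geq 3$ and let $R\geq\sqrt{3}$. Then the cylinder $$\mathrm{Z}^{2n}(1)=\{(x_1,y_1,\ldots,x_n,y_n)\in\mathbb{R}^{2n} : x_1^2+y_1^2<1\}$$ admits a symplectic embedding into the product $\mathrm{B}^4(R)\times\mathbb{R}^{2(n-2)}$.
   Context: $\mathbb{R}^{2m}$, with coordinates $(x_1,y_1,\ldots,x_m,y_m)$, carries the standard symplectic form $\sum_{i=1}^m \mathrm{d}x_i\wedge \mathrm{d}y_i$. For $R>0$, $\mathrm{B}^{2m}(R)$ denotes the open ball $\{\sum_{i=1}^m x_i^2+y_i^2<R^2\}\subset\mathbb{R}^{2m}$. A smooth embedding between open subsets of $\mathbb{R}^{2n}$ is symplectic if it pulls back the standard symplectic form to itself. Here $\mathrm{B}^4(R)\times\mathbb{R}^{2(n-2)}$ is regarded as an open subset of $\mathbb{R}^{2n}$. *)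

theory Defs
  imports "HOL-Analysis.Analysis"
begin

text \<open>Points of R^{2n} are pairs (x,y) with x, y :: real^'n, where n = CARD('n);
  the coordinate pair (x_i,y_i) is (x$i, y$i).\<close>

text \<open>C^infinity on an open set: there is a family d x [v_k,...,v_1] of iterated
  directional derivatives, d x [] = f x, and each level is differentiable with
  derivative given by the next level.\<close>
definition smooth_on :: "'a::real_normed_vector set \<Rightarrow> ('a \<Rightarrow> 'b::real_normed_vector) \<Rightarrow> bool" where
  "smooth_on S f \<longleftrightarrow> (\<exists>d :: 'a \<Rightarrow> 'a list \<Rightarrow> 'b.
      (\<forall>x\<in>S. d x [] = f x) \<and>
      (\<forall>vs. \<forall>x\<in>S. ((\<lambda>y. d y vs) has_derivative (\<lambda>h. d x (h # vs))) (at x)))"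

definition omega :: "(real^'n) \<times> (real^'n) \<Rightarrow> (real^'n) \<times> (real^'n) \<Rightarrow> real" where
  "omega u v = (\<Sum>i\<in>UNIV. fst u $ i * snd v $ i - snd u $ i * fst v $ i)"

definition smooth_embedding :: "('a::euclidean_space) set \<Rightarrow> ('a \<Rightarrow> 'a) \<Rightarrow> bool" where
  "smooth_embedding S f \<longleftrightarrow> smooth_on S f \<and> inj_on f S \<and>
     (\<forall>p\<in>S. \<exists>L. (f has_derivative L) (at p) \<and> inj L) \<and>
     (\<exists>g. homeomorphism S (f ` S) f g)"

definition symplectic_embedding ::
  "((real^'n) \<times> (real^'n)) set \<Rightarrow> ((real^'n) \<times> (real^'n)) set
     \<Rightarrow> ((real^'n) \<times> (real^'n) \<Rightarrow> (real^'n) \<times> (real^'n)) \<Rightarrow> bool" where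
  "symplectic_embedding U V f \<longleftrightarrow> smooth_embedding U f \<and> f ` U \<subseteq> V \<and>
     (\<forall>p\<in>U. \<exists>L. (f has_derivative L) (at p) \<and> (\<forall>u v. omega (L u) (L v) = omega u v))"

definition cylinder :: "'n \<Rightarrow> real \<Rightarrow> ((real^'n) \<times> (real^'n)) set" where
  "cylinder a r = {(x,y). (x$a)^2 + (y$a)^2 < r^2}"

definition ball_prod :: "'n \<Rightarrow> 'n \<Rightarrow> real \<Rightarrow> ((real^'n) \<times> (real^'n)) set" where
  "ball_prod a b R = {(x,y). (x$a)^2 + (y$a)^2 + (x$b)^2 + (y$b)^2 < R^2}"

end

theory Submission
  imports Defs
begin

text \<open>
  The embedding is explicit; it is a version of the constructions of Guth and Hind--Kerman arranged
  so that no epsilon is lost.  Write \<open>z\<close> for the \<open>a\<close>-plane, \<open>w\<close> for the \<open>b\<close>-plane and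
  \<open>(c, v)\<close> for a third plane.

  The \<open>z\<close>-disc is mapped to the half-disc with action-angle coordinates \<open>0 < \<rho> < 1\<close>,
  \<open>0 < \<theta> < \<pi>\<close>.  The \<open>w\<close>-plane is wound onto a thin annulus around the circle of action \<open>1/2\<close>.
  Winding is not injective, so at every turn a Hamiltonian of the form \<open>v \<chi>\<close> leads the strand off along a
  second closed curve crossing the circle, which shifts \<open>c\<close> by one at each turn and thereby separates
  different turns.  The second curve is the graph of \<open>\<psi> \<mapsto> 1/2 + (1 - \<rho>) d arccos (r cos (\<psi>/2)) / d\<psi>\<close>
  over a circle of length \<open>4\<pi>\<close>; along it \<open>\<theta>\<close> is rotated by \<open>arccos (r cos (\<psi>/2))\<close>, which for
  \<open>r\<close> near \<open>1\<close> is close to \<open>0\<close> at the wanted crossing and close to \<open>\<pi>\<close> at the unwanted one, where the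
  half-disc is therefore displaced from itself.  The slope of \<open>arccos (r cos (\<psi>/2))\<close> is below \<open>1/2\<close>, so the
  two actions add up to less than \<open>\<rho> + 1/2 + (1 - \<rho>)/2 < 3/2\<close>, up to the width of the strands.

  The widths, and \<open>1 - r\<close>, have to tend to zero at the boundary of the disc.  To arrange this, the
  Hamiltonian \<open>(s - c) / (1 - |z|^2)\<close> first rotates \<open>z\<close> and pushes \<open>v\<close> and the transversal coordinate of the
  annulus beyond \<open>1 / (1 - |z|^2)\<close>; all small parameters are then functions of these two quantities.
\<close>

section \<open>Smooth functions\<close>

text \<open>Level 0 imposes nothing. \<open>C_inf_on\<close> asks for all levels, and there the
  continuity of each derivative follows from its differentiability.\<close>

primrec Ck_on :: "nat \<Rightarrow> 'a::real_normed_vector set \<Rightarrow> ('a \<Rightarrow> 'b::real_normed_vector) \<Rightarrow> bool" where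
  "Ck_on 0 S f \<longleftrightarrow> True"
| "Ck_on (Suc k) S f \<longleftrightarrow> (\<forall>x\<in>S. f differentiable (at x)) \<and>
     (\<forall>h. Ck_on k S (\<lambda>x. frechet_derivative f (at x) h))"

lemma Ck_on_cong:
  assumes "open S" "\<And>x. x \<in> S \<Longrightarrow> f x = g x" "Ck_on k S f"
  shows "Ck_on k S g"
  using assms(2,3)
proof (induction k arbitrary: f g)
  case (Suc k)
  have der: "(g has_derivative frechet_derivative f (at x)) (at x)" if "x \<in> S" for x
  proof -
    have "(f has_derivative frechet_derivative f (at x)) (at x)"
      using Suc.prems(2) that frechet_derivative_works by auto
    then show ?thesis
      using has_derivative_transform_within_open[OF _ assms(1) that] Suc.prems(1) by blast
  qed
  have eq: "frechet_derivative f (at x) = frechet_derivative g (at x)" if "x \<in> S" for x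
    using frechet_derivative_at[OF der[OF that]] .
  show ?case
  proof (simp, intro conjI ballI allI)
    show "g differentiable (at x)" if "x \<in> S" for x
      using der[OF that] differentiable_def by blast
    show "Ck_on k S (\<lambda>x. frechet_derivative g (at x) h)" for h
      by (rule Suc.IH[of "\<lambda>x. frechet_derivative f (at x) h"]) (use Suc.prems(2) eq in auto)
  qed
qed simp

lemma Ck_on_SucI:
  assumes "open S" "\<And>x. x \<in> S \<Longrightarrow> (f has_derivative f' x) (at x)"
    "\<And>h. Ck_on k S (\<lambda>x. f' x h)"
  shows "Ck_on (Suc k) S f"
proof (simp, intro conjI ballI allI)
  show "f differentiable (at x)" if "x \<in> S" for x
    using assms(2)[OF that] differentiable_def by blast
  show "Ck_on k S (\<lambda>x. frechet_derivative f (at x) h)" for h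
    by (rule Ck_on_cong[OF assms(1) _ assms(3)[of h]])
      (simp add: frechet_derivative_at[OF assms(2), symmetric])
qed

lemma Ck_on_SucD:
  assumes "Ck_on (Suc k) S f" "x \<in> S"
  shows "(f has_derivative frechet_derivative f (at x)) (at x)"
  using assms frechet_derivative_works by auto

lemma Ck_on_lower: "Ck_on (Suc k) S f \<Longrightarrow> Ck_on k S f"
proof (induction k arbitrary: f)
  case (Suc k)
  then show ?case
    by (metis Ck_on.simps(2))
qed simp

text \<open>\<open>Ck_on\<close> constrains full derivatives at individual points, so it can be
  checked piece by piece. This carries smoothness from the charts to the glued map.\<close>

lemma Ck_on_local:
  assumes "\<And>x. x \<in> S \<Longrightarrow> \<exists>U. x \<in> U \<and> Ck_on k U f"
  shows "Ck_on k S f"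
  using assms
proof (induction k arbitrary: f)
  case (Suc k)
  have "f differentiable (at x)" if "x \<in> S" for x
    using Suc.prems[OF that] by auto
  moreover have "Ck_on k S (\<lambda>x. frechet_derivative f (at x) h)" for h
    by (rule Suc.IH) (use Suc.prems in fastforce)
  ultimately show ?case by auto
qed simp

lemma Ck_on_subset: "Ck_on k S f \<Longrightarrow> T \<subseteq> S \<Longrightarrow> Ck_on k T f"
  by (induction k arbitrary: f) auto

definition C_inf_on :: "'a::real_normed_vector set \<Rightarrow> ('a \<Rightarrow> 'b::real_normed_vector) \<Rightarrow> bool" where
  "C_inf_on S f \<longleftrightarrow> (\<forall>k. Ck_on k S f)"

lemma C_inf_on_differentiable:
  assumes "C_inf_on S f" "x \<in> S"
  shows "(f has_derivative frechet_derivative f (at x)) (at x)"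
proof -
  have "Ck_on (Suc 0) S f" using assms(1) by (simp only: C_inf_on_def)
  then show ?thesis using assms(2) frechet_derivative_works by auto
qed

lemma C_inf_on_frechet: "C_inf_on S f \<Longrightarrow> C_inf_on S (\<lambda>x. frechet_derivative f (at x) h)"
  unfolding C_inf_on_def by (metis Ck_on.simps(2))

text \<open>The most recent direction stands at the head, the order in which
  \<open>smooth_on\<close> extends its lists.\<close>

primrec iter_deriv :: "('a::real_normed_vector \<Rightarrow> 'b::real_normed_vector) \<Rightarrow> 'a list \<Rightarrow> 'a \<Rightarrow> 'b" where
  "iter_deriv f [] = f"
| "iter_deriv f (h # vs) = (\<lambda>x. frechet_derivative (iter_deriv f vs) (at x) h)"

lemma C_inf_on_imp_smooth_on:
  assumes "C_inf_on S f"
  shows "smooth_on S f"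
proof -
  have 1: "C_inf_on S (iter_deriv f vs)" for vs
    by (induction vs) (auto simp: assms C_inf_on_frechet)
  show ?thesis
    unfolding smooth_on_def
    by (intro exI[of _ "\<lambda>x vs. iter_deriv f vs x"]) (simp add: C_inf_on_differentiable[OF 1])
qed

lemma Ck_on_const: "open S \<Longrightarrow> Ck_on k S (\<lambda>x. c)"
proof (induction k arbitrary: c)
  case (Suc k)
  then show ?case by (intro Ck_on_SucI[where f'="\<lambda>x h. 0"]) auto
qed simp

lemma Ck_on_bounded_linear:
  assumes "open S" "bounded_linear L"
  shows "Ck_on k S L"
proof (cases k)
  case (Suc j)
  then show ?thesis
    using assms by (auto intro!: Ck_on_SucI[where f'="\<lambda>x. L"] Ck_on_const
        bounded_linear.has_derivative[OF assms(2)] has_derivative_ident simp del: Ck_on.simps)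
qed simp

lemma Ck_on_add:
  assumes "open S" "Ck_on k S f" "Ck_on k S g"
  shows "Ck_on k S (\<lambda>x. f x + g x)"
  using assms(2,3)
proof (induction k arbitrary: f g)
  case (Suc k)
  show ?case
    by (rule Ck_on_SucI[OF assms(1) has_derivative_add[OF Ck_on_SucD[OF Suc.prems(1)] Ck_on_SucD[OF Suc.prems(2)]]])
      (use Suc in auto)
qed simp

lemma Ck_on_mult:
  fixes f g :: "'a::real_normed_vector \<Rightarrow> real"
  assumes "open S" "Ck_on k S f" "Ck_on k S g"
  shows "Ck_on k S (\<lambda>x. f x * g x)"
  using assms(2,3)
proof (induction k arbitrary: f g)
  case (Suc k)
  show ?case
    by (rule Ck_on_SucI[OF assms(1) has_derivative_mult[OF Ck_on_SucD[OF Suc.prems(1)] Ck_on_SucD[OF Suc.prems(2)]]])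
      (use Suc Ck_on_lower[OF Suc.prems(1)] Ck_on_lower[OF Suc.prems(2)] in \<open>auto intro!: Ck_on_add assms(1)\<close>)
qed simp

text \<open>Chain rule plus product rule. The induction generalises over the outer function, because
  the derivative of \<open>g\<close> composed with \<open>f\<close> appears at the next
  level.\<close>

lemma Ck_on_compose_real:
  fixes f :: "'a::real_normed_vector \<Rightarrow> real" and g :: "real \<Rightarrow> real"
  assumes "open S" "Ck_on k S f" "Ck_on k I g" "f ` S \<subseteq> I"
  shows "Ck_on k S (\<lambda>x. g (f x))"
  using assms(2,3)
proof (induction k arbitrary: g)
  case (Suc k)
  have der: "((\<lambda>x. g (f x)) has_derivative (\<lambda>h. frechet_derivative f (at x) h * frechet_derivative g (at (f x)) 1)) (at x)"
    if "x \<in> S" for x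
  proof -
    have g: "(g has_derivative frechet_derivative g (at (f x))) (at (f x))"
      using Ck_on_SucD[OF Suc.prems(2)] that assms(4) by auto
    have lin: "frechet_derivative g (at (f x)) y = y * frechet_derivative g (at (f x)) 1" for y
      using linear_scale[OF has_derivative_linear[OF g], of y 1] by simp
    have "(g has_derivative (\<lambda>y. y * frechet_derivative g (at (f x)) 1)) (at (f x))"
      by (rule has_derivative_eq_rhs[OF g]) (rule ext, rule lin)
    from diff_chain_at[OF Ck_on_SucD[OF Suc.prems(1) that] this] show ?thesis
      by (simp add: o_def)
  qed
  show ?case
  proof (rule Ck_on_SucI[OF assms(1) der])
    have "Ck_on k S (\<lambda>x. frechet_derivative g (at (f x)) 1)"
      using Suc.IH[OF Ck_on_lower[OF Suc.prems(1)], of "\<lambda>y. frechet_derivative g (at y) 1"] Suc.prems(2)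
      by simp
    then show "Ck_on k S (\<lambda>x. frechet_derivative f (at x) h * frechet_derivative g (at (f x)) 1)" for h
      using Suc.prems(1) by (intro Ck_on_mult assms(1)) auto
  qed
qed simp

lemma Ck_on_componentwise:
  fixes f :: "'a::real_normed_vector \<Rightarrow> 'b::euclidean_space"
  assumes "open S" "\<And>b. b \<in> Basis \<Longrightarrow> Ck_on k S (\<lambda>x. f x \<bullet> b)"
  shows "Ck_on k S f"
  using assms(2)
proof (induction k arbitrary: f)
  case (Suc k)
  have der: "(f has_derivative (\<lambda>h. \<Sum>b\<in>Basis. frechet_derivative (\<lambda>x. f x \<bullet> b) (at x) h *\<^sub>R b)) (at x)" if "x \<in> S" for x
    unfolding has_derivative_componentwise_within[of f]
    using Ck_on_SucD[OF Suc.prems that] by (auto simp: inner_sum_left inner_Basis if_distrib cong: if_cong)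
  show ?case
  proof (rule Ck_on_SucI[OF assms(1), where f' = "\<lambda>x h. \<Sum>b\<in>Basis. frechet_derivative (\<lambda>x. f x \<bullet> b) (at x) h *\<^sub>R b"])
    show "Ck_on k S (\<lambda>x. \<Sum>b\<in>Basis. frechet_derivative (\<lambda>x. f x \<bullet> b) (at x) h *\<^sub>R b)" for h
      by (rule Suc.IH) (use Suc.prems in \<open>auto simp: inner_sum_left inner_Basis if_distrib cong: if_cong\<close>)
  qed (fact der)
qed simp

lemma Ck_on_real_SucI:
  fixes g :: "real \<Rightarrow> real"
  assumes "open I" "\<And>x. x \<in> I \<Longrightarrow> (g has_real_derivative g' x) (at x)" "Ck_on k I g'"
  shows "Ck_on (Suc k) I g"
proof (rule Ck_on_SucI[OF assms(1), where f' = "\<lambda>x h. g' x * h"])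
  show "(g has_derivative (\<lambda>h. g' x * h)) (at x)" if "x \<in> I" for x
    using assms(2)[OF that] by (simp add: has_field_derivative_def)
  show "Ck_on k I (\<lambda>x. g' x * h)" for h
    using assms by (intro Ck_on_mult Ck_on_const)
qed

lemma C_inf_on_cong:
  assumes "open S" "\<And>x. x \<in> S \<Longrightarrow> f x = g x" "C_inf_on S f"
  shows "C_inf_on S g"
proof -
  have "Ck_on k S g" for k
    by (rule Ck_on_cong[OF assms(1,2)]) (use assms(3) in \<open>simp_all add: C_inf_on_def\<close>)
  then show ?thesis by (simp add: C_inf_on_def)
qed

lemma C_inf_on_const: "open S \<Longrightarrow> C_inf_on S (\<lambda>x. c)"
  by (simp add: C_inf_on_def Ck_on_const)

lemma C_inf_on_bounded_linear: "open S \<Longrightarrow> bounded_linear L \<Longrightarrow> C_inf_on S L"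
  by (simp add: C_inf_on_def Ck_on_bounded_linear)

lemma C_inf_on_add: "open S \<Longrightarrow> C_inf_on S f \<Longrightarrow> C_inf_on S g \<Longrightarrow> C_inf_on S (\<lambda>x. f x + g x)"
  by (simp add: C_inf_on_def Ck_on_add)

lemma C_inf_on_mult:
  fixes f g :: "'a::real_normed_vector \<Rightarrow> real"
  shows "open S \<Longrightarrow> C_inf_on S f \<Longrightarrow> C_inf_on S g \<Longrightarrow> C_inf_on S (\<lambda>x. f x * g x)"
  by (simp add: C_inf_on_def Ck_on_mult)

lemma C_inf_on_uminus:
  fixes f :: "'a::real_normed_vector \<Rightarrow> real"
  assumes "open S" "C_inf_on S f"
  shows "C_inf_on S (\<lambda>x. - f x)"
  using C_inf_on_mult[OF assms(1) C_inf_on_const[OF assms(1), of "-1"] assms(2)] by simp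

lemma C_inf_on_diff:
  fixes f g :: "'a::real_normed_vector \<Rightarrow> real"
  assumes "open S" "C_inf_on S f" "C_inf_on S g"
  shows "C_inf_on S (\<lambda>x. f x - g x)"
  using C_inf_on_add[OF assms(1,2) C_inf_on_uminus[OF assms(1,3)]] by simp

lemma C_inf_on_power:
  fixes f :: "'a::real_normed_vector \<Rightarrow> real"
  assumes "open S" "C_inf_on S f"
  shows "C_inf_on S (\<lambda>x. f x ^ n)"
proof (induction n)
  case (Suc n)
  show ?case
    unfolding power_Suc by (rule C_inf_on_mult[OF assms Suc])
qed (simp add: assms(1) C_inf_on_const)

lemma C_inf_on_compose_real:
  fixes f :: "'a::real_normed_vector \<Rightarrow> real" and g :: "real \<Rightarrow> real"
  assumes "open S" "C_inf_on S f" "C_inf_on I g" "\<And>x. x \<in> S \<Longrightarrow> f x \<in> I"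
  shows "C_inf_on S (\<lambda>x. g (f x))"
  unfolding C_inf_on_def
  by (intro allI Ck_on_compose_real[of S _ f I g]) (use assms in \<open>auto simp: C_inf_on_def\<close>)

lemma C_inf_on_componentwise:
  fixes f :: "'a::real_normed_vector \<Rightarrow> 'b::euclidean_space"
  assumes "open S" "\<And>b. b \<in> Basis \<Longrightarrow> C_inf_on S (\<lambda>x. f x \<bullet> b)"
  shows "C_inf_on S f"
  unfolding C_inf_on_def
  by (rule allI, rule Ck_on_componentwise) (use assms in \<open>auto simp: C_inf_on_def\<close>)

lemma C_inf_on_local:
  assumes "\<And>x. x \<in> S \<Longrightarrow> \<exists>U. x \<in> U \<and> C_inf_on U f"
  shows "C_inf_on S f"
  unfolding C_inf_on_def
proof
  show "Ck_on k S f" for k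
    by (rule Ck_on_local) (use assms in \<open>auto simp: C_inf_on_def\<close>)
qed

lemma C_inf_on_subset:
  assumes "C_inf_on S f" "T \<subseteq> S"
  shows "C_inf_on T f"
proof -
  have "Ck_on k T f" for k
    by (rule Ck_on_subset[OF _ assms(2)]) (use assms(1) in \<open>simp add: C_inf_on_def\<close>)
  then show ?thesis by (simp add: C_inf_on_def)
qed

section \<open>Smoothness of elementary functions\<close>

lemma C_inf_on_exp_UNIV: "C_inf_on UNIV (exp :: real \<Rightarrow> real)"
proof -
  have "Ck_on k UNIV (exp :: real \<Rightarrow> real)" for k
  proof (induction k)
    case (Suc k)
    show ?case by (rule Ck_on_real_SucI[OF _ _ Suc]) (auto intro: DERIV_exp)
  qed simp
  then show ?thesis by (simp add: C_inf_on_def)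
qed

text \<open>One simultaneous induction, since each function is up to sign the derivative of the
  other.\<close>

lemma C_inf_on_sin_cos_UNIV: "C_inf_on UNIV (sin :: real \<Rightarrow> real)" "C_inf_on UNIV (cos :: real \<Rightarrow> real)"
proof -
  have "Ck_on k UNIV (sin :: real \<Rightarrow> real) \<and> Ck_on k UNIV (cos :: real \<Rightarrow> real)" for k
  proof (induction k)
    case (Suc k)
    then have "Ck_on k UNIV (\<lambda>x::real. (-1) * sin x)"
      by (intro Ck_on_mult Ck_on_const) auto
    then have "Ck_on (Suc k) UNIV (cos :: real \<Rightarrow> real)"
      by (rule Ck_on_real_SucI[rotated 2]) (auto intro: DERIV_cos)
    moreover have "Ck_on (Suc k) UNIV (sin :: real \<Rightarrow> real)"
      by (rule Ck_on_real_SucI[where g' = cos]) (use Suc in \<open>auto intro: DERIV_sin\<close>)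
    ultimately show ?case by blast
  qed simp
  then show "C_inf_on UNIV (sin :: real \<Rightarrow> real)" "C_inf_on UNIV (cos :: real \<Rightarrow> real)"
    by (auto simp: C_inf_on_def)
qed

lemma C_inf_on_inverse_nonzero: "C_inf_on {x::real. x \<noteq> 0} inverse"
proof -
  have op: "open {x::real. x \<noteq> 0}"
    by (simp add: open_Collect_neq)
  have "Ck_on k {x::real. x \<noteq> 0} inverse" for k
  proof (induction k)
    case (Suc k)
    have "Ck_on k {x::real. x \<noteq> 0} (\<lambda>x. (-1) * (inverse x * inverse x))"
      by (intro Ck_on_mult Ck_on_const Suc op)
    then show ?case
      by (rule Ck_on_real_SucI[OF op, rotated 1]) (auto intro!: derivative_eq_intros)
  qed simp
  then show ?thesis by (simp add: C_inf_on_def)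
qed

lemma C_inf_on_sqrt_pos: "C_inf_on {0<..} sqrt"
proof -
  have "Ck_on k {0<..} sqrt" for k
  proof (induction k)
    case (Suc k)
    have "Ck_on k {0<..} (\<lambda>x::real. inverse (sqrt x) * (1/2))"
      by (intro Ck_on_mult Ck_on_const Ck_on_compose_real[OF _ Suc, of "{x. x \<noteq> 0}"])
        (use C_inf_on_inverse_nonzero in \<open>auto simp: C_inf_on_def\<close>)
    then show ?case
      by (rule Ck_on_real_SucI[rotated 2]) (auto intro!: derivative_eq_intros)
  qed simp
  then show ?thesis by (simp add: C_inf_on_def)
qed

text \<open>Reduces \<open>arctan\<close>, \<open>arcsin\<close> and \<open>arccos\<close> to their
  algebraic derivatives.\<close>

lemma C_inf_on_antiderivative:
  fixes g :: "real \<Rightarrow> real"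
  assumes "open I" "\<And>x. x \<in> I \<Longrightarrow> (g has_real_derivative g' x) (at x)" "C_inf_on I g'"
  shows "C_inf_on I g"
  unfolding C_inf_on_def
proof
  fix k show "Ck_on k I g"
  proof (cases k)
    case (Suc j)
    have "Ck_on j I g'"
      using assms(3) by (simp add: C_inf_on_def)
    then show ?thesis
      using Ck_on_real_SucI[OF assms(1,2)] Suc by blast
  qed simp
qed

lemma C_inf_on_inverse:
  fixes f :: "'a::real_normed_vector \<Rightarrow> real"
  assumes "open S" "C_inf_on S f" "\<And>x. x \<in> S \<Longrightarrow> f x \<noteq> 0"
  shows "C_inf_on S (\<lambda>x. inverse (f x))"
  by (rule C_inf_on_compose_real[OF _ _ C_inf_on_inverse_nonzero]) (use assms in auto)

lemma C_inf_on_divide: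
  fixes f g :: "'a::real_normed_vector \<Rightarrow> real"
  assumes "open S" "C_inf_on S f" "C_inf_on S g" "\<And>x. x \<in> S \<Longrightarrow> g x \<noteq> 0"
  shows "C_inf_on S (\<lambda>x. f x / g x)"
  unfolding divide_inverse using assms by (intro C_inf_on_mult C_inf_on_inverse)

lemma C_inf_on_sqrt:
  assumes "open S" "C_inf_on S f" "\<And>x. x \<in> S \<Longrightarrow> f x > 0"
  shows "C_inf_on S (\<lambda>x. sqrt (f x))"
  by (rule C_inf_on_compose_real[OF _ _ C_inf_on_sqrt_pos]) (use assms in auto)

lemma C_inf_on_exp:
  fixes f :: "'a::real_normed_vector \<Rightarrow> real"
  assumes "open S" "C_inf_on S f"
  shows "C_inf_on S (\<lambda>x. exp (f x))"
  by (rule C_inf_on_compose_real[OF _ _ C_inf_on_exp_UNIV]) (use assms in auto)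

lemma C_inf_on_sin:
  fixes f :: "'a::real_normed_vector \<Rightarrow> real"
  assumes "open S" "C_inf_on S f"
  shows "C_inf_on S (\<lambda>x. sin (f x))"
  by (rule C_inf_on_compose_real[OF _ _ C_inf_on_sin_cos_UNIV(1)]) (use assms in auto)

lemma C_inf_on_cos:
  fixes f :: "'a::real_normed_vector \<Rightarrow> real"
  assumes "open S" "C_inf_on S f"
  shows "C_inf_on S (\<lambda>x. cos (f x))"
  by (rule C_inf_on_compose_real[OF _ _ C_inf_on_sin_cos_UNIV(2)]) (use assms in auto)

lemma C_inf_on_ident: "open S \<Longrightarrow> C_inf_on S (\<lambda>x. x)"
  using C_inf_on_bounded_linear[OF _ bounded_linear_ident] .

lemma C_inf_on_arctan:
  assumes "open S" "C_inf_on S f"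
  shows "C_inf_on S (\<lambda>x. arctan (f x))"
proof -
  have nz: "1 + x\<^sup>2 \<noteq> 0" for x :: real
    using zero_le_power2[of x] by linarith
  have "C_inf_on UNIV arctan"
    by (rule C_inf_on_antiderivative[OF open_UNIV DERIV_arctan])
      (intro C_inf_on_inverse C_inf_on_add C_inf_on_const C_inf_on_power C_inf_on_ident open_UNIV nz)
  from C_inf_on_compose_real[OF assms(1,2) this] show ?thesis
    by simp
qed

lemma C_inf_on_inverse_sqrt_one_minus_square: "C_inf_on {-1<..<1} (\<lambda>x::real. inverse (sqrt (1 - x\<^sup>2)))"
  by (intro C_inf_on_inverse C_inf_on_sqrt C_inf_on_diff C_inf_on_const C_inf_on_power C_inf_on_ident)
    (auto simp: abs_square_less_1 power2_eq_1_iff)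

lemma C_inf_on_arcsin:
  assumes "open S" "C_inf_on S f" "\<And>x. x \<in> S \<Longrightarrow> \<bar>f x\<bar> < 1"
  shows "C_inf_on S (\<lambda>x. arcsin (f x))"
proof -
  have "C_inf_on {-1<..<1} arcsin"
    by (rule C_inf_on_antiderivative[OF _ _ C_inf_on_inverse_sqrt_one_minus_square])
      (auto intro: DERIV_arcsin)
  from C_inf_on_compose_real[OF assms(1,2) this] show ?thesis
    using assms(3) by (simp add: abs_less_iff minus_less_iff)
qed

lemma C_inf_on_arccos:
  assumes "open S" "C_inf_on S f" "\<And>x. x \<in> S \<Longrightarrow> \<bar>f x\<bar> < 1"
  shows "C_inf_on S (\<lambda>x. arccos (f x))"
proof -
  have "C_inf_on {-1<..<1} arccos"
    by (rule C_inf_on_antiderivative[OF _ _ C_inf_on_uminus[OF _ C_inf_on_inverse_sqrt_one_minus_square]])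
      (use DERIV_arccos in auto)
  from C_inf_on_compose_real[OF assms(1,2) this] show ?thesis
    using assms(3) by (simp add: abs_less_iff minus_less_iff)
qed

section \<open>A smooth step function\<close>

definition flat :: "nat \<Rightarrow> real \<Rightarrow> real" where
  "flat n x = (if x > 0 then exp (- (1 / x)) * (1 / x) ^ n else 0)"

text \<open>The term of degree \<open>n + 2\<close> in the exponential series at
  \<open>1 / x\<close> already gives this. The quadratic bound is what makes the derivative at 0
  exist and vanish.\<close>

lemma flat_le:
  assumes "x > 0"
  shows "flat n x \<le> fact (n + 2) * x\<^sup>2"
proof -
  have "sum (\<lambda>n. inverse (fact n) * (1/x)^n) {n+2} \<le> (\<Sum>n. inverse (fact n) * (1/x)^n)"
    by (rule sum_le_suminf[OF summable_exp]) (use assms in auto)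
  also have "\<dots> = exp (1/x)"
    using sums_unique[OF exp_converges[of "1/x"]] by simp
  finally have le: "inverse (fact (n+2)) * (1/x)^(n+2) \<le> exp (1/x)"
    by simp
  define F and y where "F = (fact (n+2) :: real)" and "y = (1/x)^(n+2)"
  have "F > 0" "inverse F * y \<le> exp (1/x)"
    using le by (simp_all only: F_def y_def fact_gt_zero)
  then have "exp (- (1/x)) * y \<le> F"
    by (simp add: exp_minus field_simps)
  then have "exp (- (1/x)) * (1/x)^(n+2) \<le> fact (n+2)"
    by (simp only: F_def y_def)
  then have "exp (- (1/x)) * (1/x)^(n+2) * x\<^sup>2 \<le> fact (n+2) * x\<^sup>2"
    by (intro mult_right_mono) auto
  then show ?thesis
    using assms by (simp add: flat_def power_add power2_eq_square)
qed

lemma flat_nonneg: "flat n x \<ge> 0"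
  by (simp add: flat_def)

text \<open>Differentiation stays inside the family up to linear combinations, so smoothness follows
  by induction with \<open>n\<close> arbitrary.\<close>

lemma flat_has_derivative:
  "(flat n has_real_derivative flat (n + 2) x - n * flat (n + 1) x) (at x)"
proof (cases x "0::real" rule: linorder_cases)
  case greater
  have "((\<lambda>x. exp (- (1 / x)) * (1 / x) ^ n) has_real_derivative flat (n + 2) x - n * flat (n + 1) x) (at x)"
  proof -
    have d1: "((\<lambda>x. 1 / x) has_real_derivative - (1 / x)\<^sup>2) (at x)"
      using greater by (auto intro!: derivative_eq_intros simp: power2_eq_square)
    have d2: "((\<lambda>x. (1 / x) ^ n) has_real_derivative - real n * (1 / x) ^ (n + 1)) (at x)"
    proof (induction n)
      case (Suc n)
      show ?case
        unfolding power_Suc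
        by (rule DERIV_cong[OF DERIV_mult[OF d1 Suc]]) (simp add: algebra_simps power2_eq_square add_divide_distrib diff_divide_distrib)
    qed simp
    have d3: "((\<lambda>x. exp (- (1 / x))) has_real_derivative exp (- (1 / x)) * (1 / x)\<^sup>2) (at x)"
      by (rule DERIV_cong[OF DERIV_chain2[OF DERIV_exp DERIV_minus[OF d1]]]) simp
    show ?thesis
      by (rule DERIV_cong[OF DERIV_mult[OF d3 d2]])
        (use greater in \<open>simp add: flat_def power_add power2_eq_square algebra_simps\<close>)
  qed
  then show ?thesis
    by (rule has_field_derivative_transform_within_open[where S="{0<..}"]) (use greater in \<open>auto simp: flat_def\<close>)
next
  case less
  have "((\<lambda>x. 0) has_real_derivative flat (n + 2) x - n * flat (n + 1) x) (at x)"
    using less by (auto simp: flat_def)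
  then show ?thesis
    by (rule has_field_derivative_transform_within_open[where S="{..<0}"]) (use less in \<open>auto simp: flat_def\<close>)
next
  case equal
  have bd: "norm (flat n y / y) \<le> fact (n+2) * \<bar>y\<bar>" for y
  proof (cases "y > 0")
    case True
    have "flat n y / y \<le> (fact (n+2) * y\<^sup>2) / y"
      using flat_le[OF True, of n] True by (intro divide_right_mono) auto
    also have "\<dots> = fact (n+2) * y"
      using True by (simp only: power2_eq_square) simp
    finally show ?thesis
      using flat_nonneg[of n y] True by (simp only: real_norm_def abs_of_pos abs_of_nonneg divide_nonneg_pos)
  next
    case False
    then have "norm (flat n y / y) = 0" by (simp add: flat_def)
    then show ?thesis by (simp only: mult_nonneg_nonneg fact_ge_zero abs_ge_zero)
  qed
  have "((\<lambda>y. fact (n+2) * \<bar>y\<bar>) \<longlongrightarrow> fact (n+2) * \<bar>0\<bar>) (at (0::real))"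
    by (intro tendsto_intros)
  then have lim: "((\<lambda>y. fact (n+2) * \<bar>y\<bar>) \<longlongrightarrow> 0) (at (0::real))"
    by simp
  have "((\<lambda>y. flat n y / y) \<longlongrightarrow> 0) (at 0)"
    by (rule Lim_null_comparison[OF _ lim]) (simp only: bd eventually_True)
  then have "(flat n has_real_derivative 0) (at 0)"
    by (simp add: has_field_derivative_iff flat_def)
  then show ?thesis
    by (simp add: equal flat_def)
qed

lemma C_inf_on_flat: "C_inf_on UNIV (flat n)"
proof -
  have "Ck_on k UNIV (flat n)" for k
  proof (induction k arbitrary: n)
    case (Suc k)
    have "Ck_on k UNIV (\<lambda>x. flat (n + 2) x + (- real n) * flat (n + 1) x)"
      by (intro Ck_on_add Ck_on_mult Ck_on_const Suc open_UNIV)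
    then show ?case
      using flat_has_derivative[of n] by (intro Ck_on_real_SucI[of UNIV "flat n"]) auto
  qed simp
  then show ?thesis by (simp add: C_inf_on_def)
qed

definition smooth_step :: "real \<Rightarrow> real" where
  "smooth_step x = flat 0 (1 + x) / (flat 0 (1 + x) + flat 0 (1 - x))"

lemma C_inf_on_smooth_step: "C_inf_on UNIV smooth_step"
proof -
  have nz: "flat 0 (1 + x) + flat 0 (1 - x) \<noteq> 0" for x
  proof -
    have "flat 0 (1 + x) > 0 \<or> flat 0 (1 - x) > 0"
      by (auto simp: flat_def)
    then show ?thesis
      using flat_nonneg[of 0 "1 + x"] flat_nonneg[of 0 "1 - x"] by linarith
  qed
  have f: "C_inf_on UNIV (\<lambda>x. flat 0 (1 + x))" "C_inf_on UNIV (\<lambda>x. flat 0 (1 - x))"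
    by (rule C_inf_on_compose_real[OF _ _ C_inf_on_flat[of 0]];
        auto intro!: C_inf_on_add C_inf_on_diff C_inf_on_const C_inf_on_ident)+
  show ?thesis
    unfolding smooth_step_def[abs_def]
    by (intro C_inf_on_divide C_inf_on_add f nz open_UNIV)
qed

lemma smooth_step_eq_0: "x \<le> -1 \<Longrightarrow> smooth_step x = 0"
  and smooth_step_eq_1: "x \<ge> 1 \<Longrightarrow> smooth_step x = 1"
  by (auto simp: smooth_step_def flat_def)

definition smooth_step' :: "real \<Rightarrow> real" where
  "smooth_step' x = frechet_derivative smooth_step (at x) 1"

lemma C_inf_on_smooth_step': "C_inf_on UNIV smooth_step'"
  unfolding smooth_step'_def[abs_def] by (rule C_inf_on_frechet[OF C_inf_on_smooth_step])

lemma has_real_derivative_frechet: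
  fixes g :: "real \<Rightarrow> real"
  assumes "C_inf_on UNIV g"
  shows "(g has_real_derivative frechet_derivative g (at x) 1) (at x)"
proof -
  have g: "(g has_derivative frechet_derivative g (at x)) (at x)"
    using C_inf_on_differentiable[OF assms] by simp
  have "frechet_derivative g (at x) y = frechet_derivative g (at x) 1 * y" for y
    using linear_scale[OF has_derivative_linear[OF g], of y 1] by simp
  then show ?thesis
    unfolding has_field_derivative_def by (intro has_derivative_eq_rhs[OF g] ext)
qed

lemma smooth_step_has_derivative: "(smooth_step has_real_derivative smooth_step' x) (at x)"
  unfolding smooth_step'_def by (rule has_real_derivative_frechet[OF C_inf_on_smooth_step])

lemma smooth_step'_eq_0:
  assumes "\<bar>x\<bar> \<ge> 1"
  shows "smooth_step' x = 0"
proof -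
  have 0: "smooth_step' x = 0" if "\<bar>x\<bar> > 1" for x
  proof -
    have "(smooth_step has_real_derivative 0) (at x)"
    proof (cases "x > 0")
      case True
      have "((\<lambda>x. 1) has_real_derivative 0) (at x)" by simp
      then show ?thesis
        by (rule has_field_derivative_transform_within_open[where S="{1<..}"])
          (use that True in \<open>auto simp: smooth_step_eq_1\<close>)
    next
      case False
      have "((\<lambda>x. 0) has_real_derivative 0) (at x)" by simp
      then show ?thesis
        by (rule has_field_derivative_transform_within_open[where S="{..<-1}"])
          (use that False in \<open>auto simp: smooth_step_eq_0\<close>)
    qed
    then show ?thesis
      using DERIV_unique smooth_step_has_derivative by blast
  qed
  have c: "isCont smooth_step' x"
    using has_real_derivative_frechet[OF C_inf_on_smooth_step'] DERIV_isCont by blast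
  \<comment> \<open>These points lie strictly outside \<open>[-1, 1]\<close> and tend to
    \<open>x\<close>, so continuity covers the end points.\<close>
  let ?s = "\<lambda>n. x * (1 + 1 / real (Suc n))"
  have "?s \<longlonglongrightarrow> x * (1 + 0)"
    by (intro tendsto_intros LIMSEQ_Suc lim_inverse_n')
  then have "(\<lambda>n. smooth_step' (?s n)) \<longlonglongrightarrow> smooth_step' x"
    using isCont_tendsto_compose[OF c] by simp
  moreover have "smooth_step' (?s n) = 0" for n
  proof (rule 0)
    have "1 * 1 < \<bar>x\<bar> * (1 + 1 / real (Suc n))"
      by (rule mult_le_less_imp_less) (use assms in auto)
    then show "1 < \<bar>?s n\<bar>"
      by (simp add: abs_mult)
  qed
  ultimately show ?thesis
    by (simp add: LIMSEQ_const_iff)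
qed

section \<open>Symplectic coordinate changes\<close>

text \<open>Six functions which at \<open>p\<close> pull back the standard form of \<open>R^6\<close> to \<open>\<Omega>\<close>.\<close>

definition symp_frame :: "'a::real_normed_vector \<Rightarrow> ('a \<Rightarrow> 'a \<Rightarrow> real) \<Rightarrow> ('a \<Rightarrow> real) \<Rightarrow> ('a \<Rightarrow> real) \<Rightarrow>
    ('a \<Rightarrow> real) \<Rightarrow> ('a \<Rightarrow> real) \<Rightarrow> ('a \<Rightarrow> real) \<Rightarrow> ('a \<Rightarrow> real) \<Rightarrow> bool" where
  "symp_frame p \<Omega> x1 y1 x2 y2 x3 y3 \<longleftrightarrow> (\<exists>dx1 dy1 dx2 dy2 dx3 dy3.
     (x1 has_derivative dx1) (at p) \<and> (y1 has_derivative dy1) (at p) \<and>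
     (x2 has_derivative dx2) (at p) \<and> (y2 has_derivative dy2) (at p) \<and>
     (x3 has_derivative dx3) (at p) \<and> (y3 has_derivative dy3) (at p) \<and>
     (\<forall>u v. (dx1 u * dy1 v - dx1 v * dy1 u) + (dx2 u * dy2 v - dx2 v * dy2 u)
          + (dx3 u * dy3 v - dx3 v * dy3 u) = \<Omega> u v))"

lemma symp_frameI:
  assumes "(x1 has_derivative dx1) (at p)" "(y1 has_derivative dy1) (at p)"
    "(x2 has_derivative dx2) (at p)" "(y2 has_derivative dy2) (at p)"
    "(x3 has_derivative dx3) (at p)" "(y3 has_derivative dy3) (at p)"
    "\<And>u v. (dx1 u * dy1 v - dx1 v * dy1 u) + (dx2 u * dy2 v - dx2 v * dy2 u)
          + (dx3 u * dy3 v - dx3 v * dy3 u) = \<Omega> u v"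
  shows "symp_frame p \<Omega> x1 y1 x2 y2 x3 y3"
  unfolding symp_frame_def using assms by blast

lemma symp_frameE:
  assumes "symp_frame p \<Omega> x1 y1 x2 y2 x3 y3"
  obtains dx1 dy1 dx2 dy2 dx3 dy3 where
    "(x1 has_derivative dx1) (at p)" "(y1 has_derivative dy1) (at p)"
    "(x2 has_derivative dx2) (at p)" "(y2 has_derivative dy2) (at p)"
    "(x3 has_derivative dx3) (at p)" "(y3 has_derivative dy3) (at p)"
    "\<And>u v. \<Omega> u v = (dx1 u * dy1 v - dx1 v * dy1 u) + (dx2 u * dy2 v - dx2 v * dy2 u)
          + (dx3 u * dy3 v - dx3 v * dy3 u)"
  using assms unfolding symp_frame_def by metis

text \<open>Brings the next plane to the front, where the lemmas below act; three applications
  restore the order.\<close>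

lemma symp_frame_cycle:
  assumes "symp_frame p \<Omega> x1 y1 x2 y2 x3 y3"
  shows "symp_frame p \<Omega> x2 y2 x3 y3 x1 y1"
  using assms by (elim symp_frameE) (rule symp_frameI, assumption+, simp)

lemma symp_frame_translate:
  assumes "symp_frame p \<Omega> x1 y1 x2 y2 x3 y3"
  shows "symp_frame p \<Omega> (\<lambda>p. x1 p + a) (\<lambda>p. y1 p + b) x2 y2 x3 y3"
  using assms by (elim symp_frameE) (rule symp_frameI, (rule has_derivative_add_const | assumption)+, simp)

text \<open>A change of coordinates in the first plane multiplies only the first summand of the
  form, and by its Jacobian determinant.\<close>

lemma symp_frame_plane:
  assumes "symp_frame p \<Omega> x1 y1 x2 y2 x3 y3"
    and f: "\<And>d e. (x1 has_derivative d) (at p) \<Longrightarrow> (y1 has_derivative e) (at p) \<Longrightarrow>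
      (f has_derivative (\<lambda>u. fx * d u + fy * e u)) (at p)"
    and g: "\<And>d e. (x1 has_derivative d) (at p) \<Longrightarrow> (y1 has_derivative e) (at p) \<Longrightarrow>
      (g has_derivative (\<lambda>u. gx * d u + gy * e u)) (at p)"
    and det: "fx * gy - fy * gx = 1"
  shows "symp_frame p \<Omega> f g x2 y2 x3 y3"
  using assms(1)
proof (elim symp_frameE, goal_cases)
  case (1 d1 e1 d2 e2 d3 e3)
  show ?case
  proof (rule symp_frameI[OF f[OF 1(1,2)] g[OF 1(1,2)] 1(3-6)])
    fix u v
    have "(fx * d1 u + fy * e1 u) * (gx * d1 v + gy * e1 v) - (fx * d1 v + fy * e1 v) * (gx * d1 u + gy * e1 u)
      = (fx * gy - fy * gx) * (d1 u * e1 v - d1 v * e1 u)"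
      by algebra
    then show "(fx * d1 u + fy * e1 u) * (gx * d1 v + gy * e1 v) - (fx * d1 v + fy * e1 v) * (gx * d1 u + gy * e1 u)
      + (d2 u * e2 v - d2 v * e2 u) + (d3 u * e3 v - d3 v * e3 u) = \<Omega> u v"
      by (simp add: 1(7) det)
  qed
qed

text \<open>Here \<open>P\<close>, \<open>Q\<close>, \<open>W\<close> are the partial derivatives of a generating function of the Poisson commuting
  coordinates \<open>x1\<close>, \<open>y2\<close>, \<open>y3\<close>, hence the symmetric matrix \<open>h\<close>.\<close>

lemma symp_frame_shear:
  assumes "symp_frame p \<Omega> x1 y1 x2 y2 x3 y3"
    and P: "\<And>d1 d2 d3. (x1 has_derivative d1) (at p) \<Longrightarrow> (y2 has_derivative d2) (at p) \<Longrightarrow> (y3 has_derivative d3) (at p) \<Longrightarrow>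
      (P has_derivative (\<lambda>u. h11 * d1 u + h12 * d2 u + h13 * d3 u)) (at p)"
    and Q: "\<And>d1 d2 d3. (x1 has_derivative d1) (at p) \<Longrightarrow> (y2 has_derivative d2) (at p) \<Longrightarrow> (y3 has_derivative d3) (at p) \<Longrightarrow>
      (Q has_derivative (\<lambda>u. h12 * d1 u + h22 * d2 u + h23 * d3 u)) (at p)"
    and W: "\<And>d1 d2 d3. (x1 has_derivative d1) (at p) \<Longrightarrow> (y2 has_derivative d2) (at p) \<Longrightarrow> (y3 has_derivative d3) (at p) \<Longrightarrow>
      (W has_derivative (\<lambda>u. h13 * d1 u + h23 * d2 u + h33 * d3 u)) (at p)"
  shows "symp_frame p \<Omega> x1 (\<lambda>p. y1 p - e * P p) (\<lambda>p. x2 p + e * Q p) y2 (\<lambda>p. x3 p + e * W p) y3"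
  using assms(1)
proof (elim symp_frameE, goal_cases)
  case (1 d1 e1 d2 e2 d3 e3)
  show ?case
    by (rule symp_frameI[OF 1(1) has_derivative_diff[OF 1(2) has_derivative_mult_right[OF P[OF 1(1,4,6)]]]
          has_derivative_add[OF 1(3) has_derivative_mult_right[OF Q[OF 1(1,4,6)]]] 1(4)
          has_derivative_add[OF 1(5) has_derivative_mult_right[OF W[OF 1(1,4,6)]]] 1(6)])
      (simp add: 1(7) algebra_simps)
qed

text \<open>Now the generating function depends on \<open>x2\<close> and \<open>y3\<close>, again a
  Poisson commuting pair; \<open>P\<close> and \<open>Q\<close> are its partial derivatives, with
  the mixed one shared as \<open>h12\<close>.\<close>

lemma symp_frame_shear_mixed:
  assumes "symp_frame p \<Omega> x1 y1 x2 y2 x3 y3"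
    and P: "\<And>d1 d2. (x2 has_derivative d1) (at p) \<Longrightarrow> (y3 has_derivative d2) (at p) \<Longrightarrow>
      (P has_derivative (\<lambda>u. h11 * d1 u + h12 * d2 u)) (at p)"
    and Q: "\<And>d1 d2. (x2 has_derivative d1) (at p) \<Longrightarrow> (y3 has_derivative d2) (at p) \<Longrightarrow>
      (Q has_derivative (\<lambda>u. h12 * d1 u + h22 * d2 u)) (at p)"
  shows "symp_frame p \<Omega> x1 y1 x2 (\<lambda>p. y2 p - P p) (\<lambda>p. x3 p + Q p) y3"
  using assms(1)
proof (elim symp_frameE, goal_cases)
  case (1 d1 e1 d2 e2 d3 e3)
  show ?case
    by (rule symp_frameI[OF 1(1,2,3) has_derivative_diff[OF 1(4) P[OF 1(3,6)]]
          has_derivative_add[OF 1(5) Q[OF 1(3,6)]] 1(6)])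
      (simp add: 1(7) algebra_simps)
qed

text \<open>Time-one map of the Hamiltonian \<open>(s - c) / (1 - N)\<close>.\<close>

lemma symp_frame_rotate:
  fixes x y q s c v :: "'a::real_normed_vector \<Rightarrow> real"
  defines "N \<equiv> \<lambda>p. (x p)\<^sup>2 + (y p)\<^sup>2"
  defines "\<alpha> \<equiv> \<lambda>p. - 2 / (1 - N p)\<^sup>2 * (s p - c p)"
  assumes "symp_frame p \<Omega> x y q s c v" and N: "N p \<noteq> 1"
  shows "symp_frame p \<Omega> (\<lambda>p. cos (\<alpha> p) * x p - sin (\<alpha> p) * y p) (\<lambda>p. sin (\<alpha> p) * x p + cos (\<alpha> p) * y p)
     (\<lambda>p. q p + 1 / (1 - N p)) s c (\<lambda>p. v p + 1 / (1 - N p))"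
  using assms(3)
proof (elim symp_frameE, goal_cases)
  case (1 dx dy dq ds dc dv)
  define dN where "dN = (\<lambda>u. 2 * (x p * dx u + y p * dy u))"
  define H where "H = 1 / (1 - N p)"
  define g where "g = H * H"
  define k where "k = - 4 * (s p - c p) * (H * g)"
  define da where "da = (\<lambda>u. - 2 * g * (ds u - dc u) + k * dN u)"
  have N': "(N has_derivative dN) (at p)"
    unfolding N_def dN_def using 1(1,2) by (auto intro!: derivative_eq_intros simp: algebra_simps)
  have G': "((\<lambda>p. 1 / (1 - N p)) has_derivative (\<lambda>u. g * dN u)) (at p)"
    unfolding g_def H_def using N' N by (auto intro!: derivative_eq_intros simp: power2_eq_square)
  have "((\<lambda>p. - 2 * ((1 / (1 - N p)) * (1 / (1 - N p))) * (s p - c p)) has_derivative da) (at p)"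
    by (rule has_derivative_eq_rhs[OF has_derivative_mult[OF has_derivative_mult_right[OF has_derivative_mult[OF G' G']]
          has_derivative_diff[OF 1(4,5)]]])
      (auto simp: da_def k_def g_def algebra_simps simp flip: H_def)
  then have a': "(\<alpha> has_derivative da) (at p)"
    unfolding \<alpha>_def by (simp add: power2_eq_square)
  have c': "((\<lambda>p. cos (\<alpha> p)) has_derivative (\<lambda>u. - sin (\<alpha> p) * da u)) (at p)"
    and s': "((\<lambda>p. sin (\<alpha> p)) has_derivative (\<lambda>u. cos (\<alpha> p) * da u)) (at p)"
    using a' by (auto intro!: derivative_eq_intros)
  define C S where "C = cos (\<alpha> p)" and "S = sin (\<alpha> p)"
  have CS: "C * C + S * S = 1"
    by (simp add: C_def S_def flip: power2_eq_square)
  have x': "((\<lambda>p. cos (\<alpha> p) * x p - sin (\<alpha> p) * y p) has_derivative (\<lambda>u. C * dx u - S * dy u - (S * x p + C * y p) * da u)) (at p)"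
    unfolding C_def S_def
    by (rule has_derivative_eq_rhs[OF has_derivative_diff[OF has_derivative_mult[OF c' 1(1)] has_derivative_mult[OF s' 1(2)]]])
      (auto simp: algebra_simps)
  have y': "((\<lambda>p. sin (\<alpha> p) * x p + cos (\<alpha> p) * y p) has_derivative (\<lambda>u. S * dx u + C * dy u + (C * x p - S * y p) * da u)) (at p)"
    unfolding C_def S_def
    by (rule has_derivative_eq_rhs[OF has_derivative_add[OF has_derivative_mult[OF s' 1(1)] has_derivative_mult[OF c' 1(2)]]])
      (auto simp: algebra_simps)
  show ?case
  proof (rule symp_frameI[OF x' y' has_derivative_add[OF 1(3) G'] 1(4,5) has_derivative_add[OF 1(6) G']])
    fix u w
    have "(C * dx u - S * dy u - (S * x p + C * y p) * da u) * (S * dx w + C * dy w + (C * x p - S * y p) * da w) -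
      (C * dx w - S * dy w - (S * x p + C * y p) * da w) * (S * dx u + C * dy u + (C * x p - S * y p) * da u)
      = (C * C + S * S) * (dx u * dy w - dx w * dy u + (x p * dx u + y p * dy u) * da w - (x p * dx w + y p * dy w) * da u)"
      by algebra
    also have "\<dots> = dx u * dy w - dx w * dy u + dN u * da w / 2 - dN w * da u / 2"
      unfolding CS dN_def by (simp add: field_simps)
    \<comment> \<open>The multiple of \<open>dN\<close> contained in \<open>da\<close> cancels in
      the alternating product with \<open>dN\<close>.\<close>
    also have "\<dots> = dx u * dy w - dx w * dy u - g * dN u * (ds w - dc w) + g * dN w * (ds u - dc u)"
      by (simp add: da_def field_simps)
    finally show "(C * dx u - S * dy u - (S * x p + C * y p) * da u) * (S * dx w + C * dy w + (C * x p - S * y p) * da w) -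
      (C * dx w - S * dy w - (S * x p + C * y p) * da w) * (S * dx u + C * dy u + (C * x p - S * y p) * da u)
      + ((dq u + g * dN u) * ds w - (dq w + g * dN w) * ds u) + (dc u * (dv w + g * dN w) - dc w * (dv u + g * dN u)) = \<Omega> u w"
      by (simp add: 1(7) algebra_simps)
  qed
qed

text \<open>Action-angle coordinates: the circle of action \<open>r\<close> has squared radius
  \<open>2 * r\<close>, and the square roots cancel in the determinant.\<close>

lemma symp_frame_polar:
  assumes "symp_frame p \<Omega> r t x2 y2 x3 y3" "r p > 0"
  shows "symp_frame p \<Omega> (\<lambda>p. sqrt (2 * r p) * cos (t p)) (\<lambda>p. sqrt (2 * r p) * sin (t p)) x2 y2 x3 y3"
proof (rule symp_frame_plane[OF assms(1)])
  let ?s = "sqrt (2 * r p)"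
  have s: "?s > 0" using assms(2) by simp
  fix d e assume d: "(r has_derivative d) (at p)" and e: "(t has_derivative e) (at p)"
  have s': "((\<lambda>p. sqrt (2 * r p)) has_derivative (\<lambda>u. d u / ?s)) (at p)"
    by (rule has_derivative_eq_rhs[OF DERIV_compose_FDERIV[OF DERIV_real_sqrt has_derivative_mult_right[OF d]]])
      (use assms(2) in \<open>auto simp: field_simps\<close>)
  show "((\<lambda>p. sqrt (2 * r p) * cos (t p)) has_derivative (\<lambda>u. (cos (t p) / ?s) * d u + (- ?s * sin (t p)) * e u)) (at p)"
    by (rule has_derivative_eq_rhs[OF has_derivative_mult[OF s' DERIV_compose_FDERIV[OF DERIV_cos e]]])
      (auto simp: algebra_simps)
  show "((\<lambda>p. sqrt (2 * r p) * sin (t p)) has_derivative (\<lambda>u. (sin (t p) / ?s) * d u + (?s * cos (t p)) * e u)) (at p)"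
    by (rule has_derivative_eq_rhs[OF has_derivative_mult[OF s' DERIV_compose_FDERIV[OF DERIV_sin e]]])
      (auto simp: algebra_simps)
next
  have "sqrt (2 * r p) \<noteq> 0" using assms(2) by simp
  then show "cos (t p) / sqrt (2 * r p) * (sqrt (2 * r p) * cos (t p)) - - sqrt (2 * r p) * sin (t p) * (sin (t p) / sqrt (2 * r p)) = 1"
    by (simp add: field_simps flip: power2_eq_square)
qed

section \<open>Bending and travelling\<close>

text \<open>The generating function is \<open>T = (1 - \<rho>) arccos (rr v cos (\<psi>/2))\<close>: its partial derivatives with respect to
  \<open>\<rho>\<close>, \<open>\<psi>\<close> and \<open>v\<close> are \<open>- tau\<close>, \<open>UU\<close> and \<open>VV\<close>.\<close>

definition rr :: "real \<Rightarrow> real" where "rr v = 1 - 1 / (200 * v ^ 4)"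
definition rr1 :: "real \<Rightarrow> real" where "rr1 v = 1 / (50 * v ^ 5)"

definition wS :: "real \<Rightarrow> real \<Rightarrow> real" where "wS \<psi> v = rr v * cos (\<psi> / 2)"
definition wS1 :: "real \<Rightarrow> real \<Rightarrow> real" where "wS1 \<psi> v = - (1 / 2) * (rr v * sin (\<psi> / 2))"
definition wS2 :: "real \<Rightarrow> real \<Rightarrow> real" where "wS2 \<psi> v = rr1 v * cos (\<psi> / 2)"
definition isq :: "real \<Rightarrow> real" where "isq w = inverse (sqrt (1 - w\<^sup>2))"

definition tau :: "real \<Rightarrow> real \<Rightarrow> real" where "tau \<psi> v = arccos (wS \<psi> v)"
definition UU :: "real \<Rightarrow> real \<Rightarrow> real \<Rightarrow> real" where "UU \<rho> \<psi> v = (\<rho> - 1) * (wS1 \<psi> v * isq (wS \<psi> v))"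
definition VV :: "real \<Rightarrow> real \<Rightarrow> real \<Rightarrow> real" where "VV \<rho> \<psi> v = (\<rho> - 1) * (wS2 \<psi> v * isq (wS \<psi> v))"

definition width :: "real \<Rightarrow> real" where "width v = 1 / (64 * v)"

text \<open>The partial derivatives of \<open>v smooth_step (64 v t)\<close>.\<close>

definition Kt :: "real \<Rightarrow> real \<Rightarrow> real" where "Kt t v = 64 * v\<^sup>2 * smooth_step' (64 * v * t)"
definition Kv :: "real \<Rightarrow> real \<Rightarrow> real" where "Kv t v = smooth_step (64 * v * t) + 64 * v * t * smooth_step' (64 * v * t)"

text \<open>The fourth power of \<open>v\<close> makes \<open>sqrt (1 - (rr v)^2)\<close> of order
  \<open>1 / v^2\<close>, the size of the gap that \<open>admissible\<close> leaves in the
  angle.\<close>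

lemma rr_bounds:
  assumes "v > 1"
  shows "199/200 < rr v" "rr v < 1" "1 - (rr v)\<^sup>2 \<le> 1 / (100 * v ^ 4)"
proof -
  have v: "v ^ 4 > 1" using assms by simp
  show 1: "199/200 < rr v" "rr v < 1"
    using v by (auto simp: rr_def divide_less_eq)
  have "1 - (rr v)\<^sup>2 = (1 - rr v) * (1 + rr v)"
    by (simp add: power2_eq_square algebra_simps)
  also have "\<dots> \<le> (1 - rr v) * 2"
    using 1 by (intro mult_left_mono) auto
  also have "\<dots> = 1 / (100 * v ^ 4)"
    by (simp add: rr_def)
  finally show "1 - (rr v)\<^sup>2 \<le> 1 / (100 * v ^ 4)" .
qed

lemma abs_wS_less_1:
  assumes "v > 1"
  shows "\<bar>wS \<psi> v\<bar> < 1"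
proof -
  have "\<bar>rr v\<bar> * \<bar>cos (\<psi> / 2)\<bar> \<le> \<bar>rr v\<bar> * 1"
    by (intro mult_left_mono) auto
  then show ?thesis
    unfolding wS_def abs_mult using rr_bounds(1,2)[OF assms] by linarith
qed

lemma wS_square_less_1: "v > 1 \<Longrightarrow> (wS \<psi> v)\<^sup>2 < 1"
  using abs_wS_less_1 abs_square_less_1 by blast

lemma DERIV_isq:
  assumes "w\<^sup>2 < 1"
  shows "(isq has_real_derivative w * isq w ^ 3) (at w)"
proof -
  have "sqrt (1 - w\<^sup>2) > 0" using assms by simp
  then have "((\<lambda>w. inverse (sqrt (1 - w\<^sup>2))) has_real_derivative w * inverse (sqrt (1 - w\<^sup>2)) ^ 3) (at w)"
    using assms by (auto intro!: derivative_eq_intros simp: field_simps power2_eq_square power3_eq_cube)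
  then show ?thesis by (simp add: isq_def[abs_def])
qed

lemma DERIV_rr: "v > 1 \<Longrightarrow> (rr has_real_derivative rr1 v) (at v)"
  unfolding rr_def[abs_def] rr1_def by (auto intro!: derivative_eq_intros simp: field_simps eval_nat_numeral)

lemma DERIV_rr1: "v > 1 \<Longrightarrow> (rr1 has_real_derivative - (1 / (10 * v ^ 6))) (at v)"
  unfolding rr1_def[abs_def] by (auto intro!: derivative_eq_intros simp: field_simps eval_nat_numeral)

context
  fixes p :: "'a::real_normed_vector" and \<rho> \<psi> v :: "'a \<Rightarrow> real" and d\<rho> d\<psi> dv :: "'a \<Rightarrow> real"
  assumes \<rho>': "(\<rho> has_derivative d\<rho>) (at p)" and \<psi>': "(\<psi> has_derivative d\<psi>) (at p)"
    and v': "(v has_derivative dv) (at p)" and v: "v p > 1"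
begin

lemma wS_has_derivative:
  "((\<lambda>p. wS (\<psi> p) (v p)) has_derivative (\<lambda>u. wS1 (\<psi> p) (v p) * d\<psi> u + wS2 (\<psi> p) (v p) * dv u)) (at p)"
  "((\<lambda>p. wS1 (\<psi> p) (v p)) has_derivative
     (\<lambda>u. - rr (v p) * cos (\<psi> p / 2) / 4 * d\<psi> u + (- rr1 (v p) * sin (\<psi> p / 2) / 2) * dv u)) (at p)"
  "((\<lambda>p. wS2 (\<psi> p) (v p)) has_derivative
     (\<lambda>u. (- rr1 (v p) * sin (\<psi> p / 2) / 2) * d\<psi> u + - (1 / (10 * v p ^ 6)) * cos (\<psi> p / 2) * dv u)) (at p)"
proof -
  have h: "((\<lambda>p. \<psi> p / 2) has_derivative (\<lambda>u. d\<psi> u / 2)) (at p)"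
    using \<psi>' by (auto intro!: derivative_eq_intros)
  note r = DERIV_compose_FDERIV[OF DERIV_rr[OF v] v']
  note r1 = DERIV_compose_FDERIV[OF DERIV_rr1[OF v] v']
  note c = DERIV_compose_FDERIV[OF DERIV_cos h]
  note s = DERIV_compose_FDERIV[OF DERIV_sin h]
  show "((\<lambda>p. wS (\<psi> p) (v p)) has_derivative (\<lambda>u. wS1 (\<psi> p) (v p) * d\<psi> u + wS2 (\<psi> p) (v p) * dv u)) (at p)"
    unfolding wS_def
    by (rule has_derivative_eq_rhs[OF has_derivative_mult[OF r c]]) (auto simp: wS1_def wS2_def algebra_simps)
  show "((\<lambda>p. wS1 (\<psi> p) (v p)) has_derivative
     (\<lambda>u. - rr (v p) * cos (\<psi> p / 2) / 4 * d\<psi> u + (- rr1 (v p) * sin (\<psi> p / 2) / 2) * dv u)) (at p)"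
    unfolding wS1_def
    by (rule has_derivative_eq_rhs[OF has_derivative_mult_right[OF has_derivative_mult[OF r s]]])
      (auto simp: field_simps)
  show "((\<lambda>p. wS2 (\<psi> p) (v p)) has_derivative
     (\<lambda>u. (- rr1 (v p) * sin (\<psi> p / 2) / 2) * d\<psi> u + - (1 / (10 * v p ^ 6)) * cos (\<psi> p / 2) * dv u)) (at p)"
    unfolding wS2_def
    by (rule has_derivative_eq_rhs[OF has_derivative_mult[OF r1 c]]) (auto simp: algebra_simps)
qed

lemma isq_has_derivative:
  "((\<lambda>p. isq (wS (\<psi> p) (v p))) has_derivative (\<lambda>u. wS (\<psi> p) (v p) * isq (wS (\<psi> p) (v p)) ^ 3 *
     (wS1 (\<psi> p) (v p) * d\<psi> u + wS2 (\<psi> p) (v p) * dv u))) (at p)"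
  by (rule has_derivative_eq_rhs[OF DERIV_compose_FDERIV[OF DERIV_isq[OF wS_square_less_1[OF v]] wS_has_derivative(1)]])
    (auto simp: algebra_simps)

lemma tau_has_derivative:
  "((\<lambda>p. tau (\<psi> p) (v p)) has_derivative (\<lambda>u. - isq (wS (\<psi> p) (v p)) *
     (wS1 (\<psi> p) (v p) * d\<psi> u + wS2 (\<psi> p) (v p) * dv u))) (at p)"
  unfolding tau_def
  by (rule has_derivative_eq_rhs[OF DERIV_compose_FDERIV[OF DERIV_arccos wS_has_derivative(1)]])
    (use abs_wS_less_1[OF v, of "\<psi> p"] in \<open>auto simp: isq_def\<close>)

text \<open>The coefficient of \<open>dv u\<close> is written exactly as that of
  \<open>d\<psi> u\<close> in \<open>VV_has_derivative\<close>: both are the mixed second derivative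
  of the generating function, and \<open>symp_frame_shear\<close> asks for a symmetric
  matrix.\<close>

lemma UU_has_derivative:
  "((\<lambda>p. UU (\<rho> p) (\<psi> p) (v p)) has_derivative (\<lambda>u. wS1 (\<psi> p) (v p) * isq (wS (\<psi> p) (v p)) * d\<rho> u +
     (\<rho> p - 1) * (- rr (v p) * cos (\<psi> p / 2) / 4 * isq (wS (\<psi> p) (v p)) +
        wS1 (\<psi> p) (v p) * wS1 (\<psi> p) (v p) * wS (\<psi> p) (v p) * isq (wS (\<psi> p) (v p)) ^ 3) * d\<psi> u +
     (\<rho> p - 1) * (- rr1 (v p) * sin (\<psi> p / 2) / 2 * isq (wS (\<psi> p) (v p)) +
        wS1 (\<psi> p) (v p) * wS2 (\<psi> p) (v p) * wS (\<psi> p) (v p) * isq (wS (\<psi> p) (v p)) ^ 3) * dv u)) (at p)"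
  unfolding UU_def
  by (rule has_derivative_eq_rhs[OF has_derivative_mult[OF has_derivative_diff[OF \<rho>' has_derivative_const]
        has_derivative_mult[OF wS_has_derivative(2) isq_has_derivative]]])
    (auto simp: algebra_simps)

lemma VV_has_derivative:
  "((\<lambda>p. VV (\<rho> p) (\<psi> p) (v p)) has_derivative (\<lambda>u. wS2 (\<psi> p) (v p) * isq (wS (\<psi> p) (v p)) * d\<rho> u +
     (\<rho> p - 1) * (- rr1 (v p) * sin (\<psi> p / 2) / 2 * isq (wS (\<psi> p) (v p)) +
        wS1 (\<psi> p) (v p) * wS2 (\<psi> p) (v p) * wS (\<psi> p) (v p) * isq (wS (\<psi> p) (v p)) ^ 3) * d\<psi> u +
     (\<rho> p - 1) * (- (1 / (10 * v p ^ 6)) * cos (\<psi> p / 2) * isq (wS (\<psi> p) (v p)) +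
        wS2 (\<psi> p) (v p) * wS2 (\<psi> p) (v p) * wS (\<psi> p) (v p) * isq (wS (\<psi> p) (v p)) ^ 3) * dv u)) (at p)"
  unfolding VV_def
  by (rule has_derivative_eq_rhs[OF has_derivative_mult[OF has_derivative_diff[OF \<rho>' has_derivative_const]
        has_derivative_mult[OF wS_has_derivative(3) isq_has_derivative]]])
    (auto simp: algebra_simps)

end

text \<open>The factor \<open>e\<close> acts as the time of a Hamiltonian flow. The bend is applied
  with \<open>e = - 1\<close> before the travel and with \<open>e = 1\<close> after it.\<close>

lemma symp_frame_bend:
  assumes "symp_frame p \<Omega> \<rho> \<theta> A \<psi> c v" "v p > 1"
  shows "symp_frame p \<Omega> \<rho> (\<lambda>p. \<theta> p + e * tau (\<psi> p) (v p)) (\<lambda>p. A p + e * UU (\<rho> p) (\<psi> p) (v p)) \<psi>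
    (\<lambda>p. c p + e * VV (\<rho> p) (\<psi> p) (v p)) v"
proof -
  have "symp_frame p \<Omega> \<rho> (\<lambda>p. \<theta> p - e * (- tau (\<psi> p) (v p))) (\<lambda>p. A p + e * UU (\<rho> p) (\<psi> p) (v p)) \<psi>
    (\<lambda>p. c p + e * VV (\<rho> p) (\<psi> p) (v p)) v"
  proof (rule symp_frame_shear[OF assms(1) _ UU_has_derivative[where v = v and \<rho> = \<rho> and \<psi> = \<psi>]
        VV_has_derivative[where v = v and \<rho> = \<rho> and \<psi> = \<psi>]])
    fix d1 d2 d3 assume "(\<rho> has_derivative d1) (at p)" "(\<psi> has_derivative d2) (at p)" "(v has_derivative d3) (at p)"
    from has_derivative_minus[OF tau_has_derivative[OF this assms(2)]]
    show "((\<lambda>p. - tau (\<psi> p) (v p)) has_derivative (\<lambda>u. 0 * d1 u + wS1 (\<psi> p) (v p) * isq (wS (\<psi> p) (v p)) * d2 u +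
        wS2 (\<psi> p) (v p) * isq (wS (\<psi> p) (v p)) * d3 u)) (at p)"
      by (rule has_derivative_eq_rhs) (auto simp: algebra_simps)
  qed (assumption | rule assms(2))+
  then show ?thesis by simp
qed

lemma symp_frame_travel:
  assumes "symp_frame p \<Omega> x y t \<psi> c v"
  shows "symp_frame p \<Omega> x y t (\<lambda>p. \<psi> p - Kt (t p) (v p)) (\<lambda>p. c p + Kv (t p) (v p)) v"
proof -
  let ?a = "64 * v p * t p"
  \<comment> \<open>The second derivative of the step enters the Hessian of the travelling function
    \<open>v smooth_step (64 v t)\<close>.\<close>
  define s2 where "s2 = frechet_derivative smooth_step' (at ?a) 1"
  have s2: "(smooth_step' has_real_derivative s2) (at ?a)"
    unfolding s2_def by (rule has_real_derivative_frechet[OF C_inf_on_smooth_step'])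
  have arg: "((\<lambda>p. 64 * v p * t p) has_derivative (\<lambda>u. 64 * v p * d1 u + 64 * t p * d2 u)) (at p)"
    if "(t has_derivative d1) (at p)" "(v has_derivative d2) (at p)" for d1 d2
    by (rule has_derivative_eq_rhs[OF has_derivative_mult[OF has_derivative_mult_right[OF that(2)] that(1)]]) auto
  note st = DERIV_compose_FDERIV[OF smooth_step_has_derivative arg]
  note st' = DERIV_compose_FDERIV[OF s2 arg]
  show ?thesis
  proof (rule symp_frame_shear_mixed[OF assms])
    fix d1 d2 assume d: "(t has_derivative d1) (at p)" "(v has_derivative d2) (at p)"
    have "((\<lambda>p. 64 * (v p)\<^sup>2) has_derivative (\<lambda>u. 128 * v p * d2 u)) (at p)"
      using d(2) by (auto intro!: derivative_eq_intros)
    from has_derivative_mult[OF this st'[OF d]]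
    show "((\<lambda>p. Kt (t p) (v p)) has_derivative (\<lambda>u. (64 * (v p)\<^sup>2 * s2 * 64 * v p) * d1 u +
        (128 * v p * smooth_step' ?a + 64 * 64 * (v p)\<^sup>2 * t p * s2) * d2 u)) (at p)"
      unfolding Kt_def by (rule has_derivative_eq_rhs) (auto simp: algebra_simps)
    from has_derivative_add[OF st[OF d] has_derivative_mult[OF arg[OF d] st'[OF d]]]
    show "((\<lambda>p. Kv (t p) (v p)) has_derivative (\<lambda>u. (128 * v p * smooth_step' ?a + 64 * 64 * (v p)\<^sup>2 * t p * s2) * d1 u +
        (128 * t p * smooth_step' ?a + 64 * 64 * v p * t p * t p * s2) * d2 u)) (at p)"
      unfolding Kv_def by (rule has_derivative_eq_rhs) (auto simp: algebra_simps power2_eq_square)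
  qed
qed

section \<open>Estimates for travelling and bending\<close>

lemma Kt_Kv_trivial:
  assumes "64 * v * t \<ge> 1"
  shows "Kt t v = 0" "Kv t v = 1"
  using assms by (simp_all add: Kt_def Kv_def smooth_step_eq_1 smooth_step'_eq_0)

text \<open>Outside the transition zone of the step the travelling map only translates
  \<open>c\<close>: by one on the positive side, by zero here. This difference separates the
  turns.\<close>

lemma Kt_Kv_trivial':
  assumes "64 * v * t \<le> - 1"
  shows "Kt t v = 0" "Kv t v = 0"
  using assms by (simp_all add: Kt_def Kv_def smooth_step_eq_0 smooth_step'_eq_0)

lemma Kt_nonzero:
  assumes "Kt t v \<noteq> 0" "v > 0"
  shows "\<bar>t\<bar> < width v"
proof -
  have "\<bar>64 * v * t\<bar> < 1"
    using assms(1) smooth_step'_eq_0[of "64 * v * t"] by (force simp: Kt_def)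
  then show ?thesis
    using assms(2) by (simp add: width_def abs_mult field_simps)
qed

text \<open>The bound on the sine forces \<open>x \<le> pi / 6\<close>, and there the derivative of
  the sine is at least \<open>1 / 2\<close>.\<close>

lemma sin_le_half_imp:
  assumes "0 \<le> x" "x \<le> pi / 2" "sin x \<le> 1 / 2"
  shows "x \<le> 2 * sin x"
proof (cases "x = 0")
  case False
  have x: "x \<le> pi / 6"
  proof (rule ccontr)
    assume "\<not> x \<le> pi / 6"
    then have "sin (pi / 6) < sin x"
      using assms by (intro sin_monotone_2pi) auto
    then show False using assms(3) by (simp add: sin_30)
  qed
  obtain z where z: "0 < z" "z < x" "sin x - sin 0 = (x - 0) * cos z"
    using MVT2[of 0 x sin cos] False assms(1) DERIV_sin by fastforce
  have "cos (pi / 3) \<le> cos z"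
    using z x pi_gt_zero by (intro cos_monotone_0_pi_le) linarith+
  then have "x * (1 / 2) \<le> x * cos z"
    using assms(1) by (intro mult_left_mono) (auto simp: cos_60)
  then show ?thesis using z(3) by simp
qed simp

lemma tau_bounds:
  assumes "v > 1"
  shows "0 < tau \<psi> v" "tau \<psi> v < pi"
proof -
  have "- 1 < wS \<psi> v" "wS \<psi> v < 1"
    using abs_wS_less_1[OF assms, of \<psi>] by linarith+
  then show "0 < tau \<psi> v" "tau \<psi> v < pi"
    unfolding tau_def using arccos_lt_bounded[of "wS \<psi> v"] by auto
qed

lemma UU_alt: "UU \<rho> \<psi> v = (1 - \<rho>) * (rr v * sin (\<psi> / 2)) / 2 / sqrt (1 - (wS \<psi> v)\<^sup>2)"
proof -
  have *: "(\<rho> - 1) * (- (1 / 2) * x * y) = (1 - \<rho>) * x / 2 * y" for x y :: real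
    by (simp add: field_simps)
  show ?thesis
    unfolding UU_def wS1_def isq_def * by (simp only: divide_inverse)
qed

lemma one_minus_wS_square: "1 - (wS \<psi> v)\<^sup>2 = 1 - (rr v)\<^sup>2 + (rr v * sin (\<psi> / 2))\<^sup>2"
  by (simp add: wS_def power_mult_distrib cos_squared_eq algebra_simps)

text \<open>By \<open>one_minus_wS_square\<close> and \<open>rr v < 1\<close> the root in
  \<open>UU_alt\<close> exceeds \<open>rr v * sin (\<psi> / 2)\<close> in absolute value. So the
  slope of \<open>tau\<close> in \<open>\<psi>\<close> stays below \<open>1 / 2\<close>.\<close>

lemma abs_UU_less:
  assumes "v > 1" "\<rho> < 1"
  shows "2 * \<bar>UU \<rho> \<psi> v\<bar> < 1 - \<rho>"
proof -
  let ?s = "sqrt (1 - (wS \<psi> v)\<^sup>2)"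
  have r: "(rr v)\<^sup>2 < 1" using rr_bounds[OF assms(1)] by (simp add: power_less_one_iff abs_square_less_1)
  have s: "?s > 0" using wS_square_less_1[OF assms(1)] by simp
  have "(rr v * sin (\<psi> / 2))\<^sup>2 < 1 - (wS \<psi> v)\<^sup>2"
    unfolding one_minus_wS_square using r by simp
  then have "\<bar>rr v * sin (\<psi> / 2)\<bar> < ?s"
    by (metis real_sqrt_abs real_sqrt_less_iff)
  then have "\<bar>rr v * sin (\<psi> / 2)\<bar> / ?s < 1"
    using s by simp
  then have "(1 - \<rho>) / 2 * (\<bar>rr v * sin (\<psi> / 2)\<bar> / ?s) < (1 - \<rho>) / 2 * 1"
    using assms(2) by (intro mult_strict_left_mono) auto
  then have "\<bar>UU \<rho> \<psi> v\<bar> < (1 - \<rho>) / 2"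
    using s assms(2) by (simp add: UU_alt abs_mult)
  then show ?thesis by simp
qed

text \<open>Near a crossing \<open>UU\<close> is small, so \<open>rr v * sin (\<psi> / 2)\<close> is
  small compared with the root \<open>?s\<close>, and then \<open>?s\<close>, which equals
  \<open>sin (tau \<psi> v)\<close>, is controlled by \<open>1 - (rr v)^2\<close>. The sign of the
  cosine decides which end of \<open>[0, pi]\<close> the angle is close to.\<close>

lemma tau_near_0_pi:
  assumes "v > 1" "\<rho> < 1" "8 * \<bar>UU \<rho> \<psi> v\<bar> \<le> 1 - \<rho>"
  shows "cos (\<psi> / 2) \<ge> 0 \<Longrightarrow> tau \<psi> v \<le> 2 / (9 * v\<^sup>2)"
    and "cos (\<psi> / 2) \<le> 0 \<Longrightarrow> pi - tau \<psi> v \<le> 2 / (9 * v\<^sup>2)"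
proof -
  let ?s = "sqrt (1 - (wS \<psi> v)\<^sup>2)"
  have s: "?s > 0" using wS_square_less_1[OF assms(1)] by simp
  have "(1 - \<rho>) / 2 * (\<bar>rr v * sin (\<psi> / 2)\<bar> / ?s) \<le> (1 - \<rho>) / 2 * (1 / 4)"
    using assms(2,3) s by (simp add: UU_alt abs_mult)
  then have "\<bar>rr v * sin (\<psi> / 2)\<bar> / ?s \<le> 1 / 4"
    using assms(2) by (subst (asm) mult_le_cancel_left_pos) auto
  then have "\<bar>rr v * sin (\<psi> / 2)\<bar> \<le> ?s / 4"
    using s by (simp add: field_simps)
  then have "\<bar>rr v * sin (\<psi> / 2)\<bar>\<^sup>2 \<le> (?s / 4)\<^sup>2"
    by (intro power_mono) auto
  then have "(rr v * sin (\<psi> / 2))\<^sup>2 \<le> ?s\<^sup>2 / 16"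
    by (simp add: power_divide)
  moreover have s2: "?s\<^sup>2 = 1 - (wS \<psi> v)\<^sup>2"
    using s by simp
  ultimately have "15 / 16 * ?s\<^sup>2 \<le> 1 - (rr v)\<^sup>2"
    using one_minus_wS_square[of \<psi> v] by simp
  also have "\<dots> \<le> 1 / (100 * v ^ 4)"
    by (rule rr_bounds[OF assms(1)])
  \<comment> \<open>The constant 9 is possible because \<open>15 / (16 * 81)\<close> exceeds
    \<open>1 / 100\<close>.\<close>
  also have "\<dots> \<le> 15 / 16 * (1 / (9 * v\<^sup>2))\<^sup>2"
    using assms(1) by (simp add: field_simps power2_eq_square eval_nat_numeral)
  finally have "?s\<^sup>2 \<le> (1 / (9 * v\<^sup>2))\<^sup>2" by simp
  then have s9: "?s \<le> 1 / (9 * v\<^sup>2)"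
    by (rule power2_le_imp_le) simp
  have "v\<^sup>2 > 1" using assms(1) by simp
  then have half: "1 / (9 * v\<^sup>2) \<le> 1 / 2" by (simp add: divide_le_eq)
  have w: "\<bar>wS \<psi> v\<bar> \<le> 1" using abs_wS_less_1[OF assms(1)] by (simp add: less_imp_le)
  have sin: "sin (tau \<psi> v) = ?s"
    unfolding tau_def by (rule sin_arccos_abs[OF w])
  have cos: "cos (tau \<psi> v) = wS \<psi> v"
    unfolding tau_def by (rule cos_arccos_abs[OF w])
  have r: "rr v > 0" using rr_bounds[OF assms(1)] by simp
  {
    assume "cos (\<psi> / 2) \<ge> 0"
    then have "tau \<psi> v \<le> pi / 2"
      unfolding tau_def using w r by (intro arccos_le_pi2) (auto simp: wS_def abs_le_iff)
    then show "tau \<psi> v \<le> 2 / (9 * v\<^sup>2)"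
      using sin_le_half_imp[of "tau \<psi> v"] tau_bounds[OF assms(1), of \<psi>] sin s9 half by simp
  }
  {
    assume "cos (\<psi> / 2) \<le> 0"
    then have "arccos (- wS \<psi> v) \<le> pi / 2"
      using w r by (intro arccos_le_pi2) (auto simp: wS_def abs_le_iff mult_nonneg_nonpos)
    then have "pi - tau \<psi> v \<le> pi / 2"
      unfolding tau_def using w by (simp add: arccos_minus_abs)
    then show "pi - tau \<psi> v \<le> 2 / (9 * v\<^sup>2)"
      using sin_le_half_imp[of "pi - tau \<psi> v"] tau_bounds[OF assms(1), of \<psi>] sin s9 half by simp
  }
qed

lemma cos_sin_add_int_2pi:
  fixes x :: real
  shows "cos (x + 2 * pi * of_int i) = cos x" "sin (x + 2 * pi * of_int i) = sin x"
  by (simp_all add: cos_add sin_add)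

lemma bend_periodic:
  "tau (\<psi> + 4 * pi * of_int i) v = tau \<psi> v" "UU \<rho> (\<psi> + 4 * pi * of_int i) v = UU \<rho> \<psi> v"
  "VV \<rho> (\<psi> + 4 * pi * of_int i) v = VV \<rho> \<psi> v"
proof -
  have "(\<psi> + 4 * pi * of_int i) / 2 = \<psi> / 2 + 2 * pi * of_int i" by simp
  then have "cos ((\<psi> + 4 * pi * of_int i) / 2) = cos (\<psi> / 2)" "sin ((\<psi> + 4 * pi * of_int i) / 2) = sin (\<psi> / 2)"
    by (simp_all only: cos_sin_add_int_2pi)
  then show "tau (\<psi> + 4 * pi * of_int i) v = tau \<psi> v" "UU \<rho> (\<psi> + 4 * pi * of_int i) v = UU \<rho> \<psi> v"
    "VV \<rho> (\<psi> + 4 * pi * of_int i) v = VV \<rho> \<psi> v"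
    by (simp_all only: tau_def UU_def VV_def wS_def wS1_def wS2_def)
qed

text \<open>Half of the period \<open>4 * pi\<close> exchanges the wanted and the unwanted
  crossing.\<close>

lemma bend_antiperiodic:
  assumes "v > 1"
  shows "tau (\<psi> + 2 * pi) v = pi - tau \<psi> v" "UU \<rho> (\<psi> + 2 * pi) v = - UU \<rho> \<psi> v"
proof -
  have "(\<psi> + 2 * pi) / 2 = \<psi> / 2 + pi" by simp
  then have cs: "cos ((\<psi> + 2 * pi) / 2) = - cos (\<psi> / 2)" "sin ((\<psi> + 2 * pi) / 2) = - sin (\<psi> / 2)"
    by (simp_all only: cos_periodic_pi sin_periodic_pi)
  then show "tau (\<psi> + 2 * pi) v = pi - tau \<psi> v"
    using abs_wS_less_1[OF assms, of \<psi>] by (simp add: tau_def wS_def arccos_minus_abs)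
  show "UU \<rho> (\<psi> + 2 * pi) v = - UU \<rho> \<psi> v"
    by (simp add: UU_def wS_def wS1_def isq_def cs)
qed

section \<open>The local form of the embedding: area, injectivity, overlap\<close>

definition psi2 :: "real \<Rightarrow> real \<Rightarrow> real \<Rightarrow> real \<Rightarrow> real" where
  "psi2 \<rho> \<psi> t v = \<psi> - Kt (t - UU \<rho> \<psi> v) v"
text \<open>Together with \<open>psi2\<close>, \<open>theta2\<close> and \<open>c2\<close>: the
  coordinates after bending by time \<open>-1\<close>, travelling, and bending by time
  \<open>1\<close>. The summand \<open>1 / 2\<close> is the action of the base circle.\<close>

definition area2 :: "real \<Rightarrow> real \<Rightarrow> real \<Rightarrow> real \<Rightarrow> real" where
  "area2 \<rho> \<psi> t v = 1/2 + (t - UU \<rho> \<psi> v) + UU \<rho> (psi2 \<rho> \<psi> t v) v"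
definition theta2 :: "real \<Rightarrow> real \<Rightarrow> real \<Rightarrow> real \<Rightarrow> real \<Rightarrow> real" where
  "theta2 \<rho> \<theta> \<psi> t v = \<theta> - tau \<psi> v + tau (psi2 \<rho> \<psi> t v) v"
definition c2 :: "real \<Rightarrow> real \<Rightarrow> real \<Rightarrow> real \<Rightarrow> real \<Rightarrow> real" where
  "c2 \<rho> c \<psi> t v = c - VV \<rho> \<psi> v + Kv (t - UU \<rho> \<psi> v) v + VV \<rho> (psi2 \<rho> \<psi> t v) v"

text \<open>The bounds on \<open>\<theta>\<close> leave a gap \<open>1 / v\<^sup>2\<close> between the half-disc and its rotation by \<open>\<pi>\<close>, and the bound on \<open>c\<close>
  leaves no room for the shift by one after a full turn.\<close>

definition admissible :: "real \<Rightarrow> real \<Rightarrow> real \<Rightarrow> real \<Rightarrow> real \<Rightarrow> bool" where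
  "admissible \<rho> \<theta> t c v \<longleftrightarrow> v > 1 \<and> 1 / (4 * v) < \<rho> \<and> \<rho> < 1 - 1 / (4 * v) \<and> 0 < t \<and> 16 * t < 1 - \<rho> \<and>
     1 / (2 * v\<^sup>2) < \<theta> \<and> \<theta> < pi - 1 / (2 * v\<^sup>2) \<and> \<bar>c\<bar> < 1 / 2"

lemma admissibleD:
  assumes "admissible \<rho> \<theta> t c v"
  shows "v > 1" "1 / (4 * v) < \<rho>" "\<rho> < 1 - 1 / (4 * v)" "0 < t" "16 * t < 1 - \<rho>"
    "1 / (2 * v\<^sup>2) < \<theta>" "\<theta> < pi - 1 / (2 * v\<^sup>2)" "\<bar>c\<bar> < 1 / 2" "0 < \<rho>" "\<rho> < 1"
    "16 * width v < \<rho>" "16 * width v < 1 - \<rho>"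
proof -
  show 1: "v > 1" "1 / (4 * v) < \<rho>" "\<rho> < 1 - 1 / (4 * v)" "0 < t" "16 * t < 1 - \<rho>"
    "1 / (2 * v\<^sup>2) < \<theta>" "\<theta> < pi - 1 / (2 * v\<^sup>2)" "\<bar>c\<bar> < 1 / 2"
    using assms by (auto simp: admissible_def)
  have "0 < 1 / (4 * v)" using 1(1) by simp
  then show "0 < \<rho>" "\<rho> < 1" using 1 by linarith+
  define z where "z = 1 / (4 * v)"
  have "width v = z / 16" "z < \<rho>" "\<rho> < 1 - z"
    using 1(2,3) by (simp_all add: z_def width_def)
  then show "16 * width v < \<rho>" "16 * width v < 1 - \<rho>"
    by linarith+
qed

text \<open>Either there is no displacement in angle and the action is \<open>1 / 2 + t\<close>, or
  the strand follows the second curve up to \<open>width v\<close> and \<open>abs_UU_less\<close>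
  applies. The margins \<open>16 * width v < \<rho>\<close> and
  \<open>16 * width v < 1 - \<rho>\<close> absorb the width.\<close>

lemma area2_bounds:
  assumes "admissible \<rho> \<theta> t c v"
  shows "0 < area2 \<rho> \<psi> t v" "\<rho> + area2 \<rho> \<psi> t v < 3 / 2"
proof -
  note a = admissibleD[OF assms]
  have "0 < area2 \<rho> \<psi> t v \<and> \<rho> + area2 \<rho> \<psi> t v < 3 / 2"
  proof (cases "Kt (t - UU \<rho> \<psi> v) v = 0")
    case True
    then have "area2 \<rho> \<psi> t v = 1 / 2 + t" by (simp add: area2_def psi2_def)
    then show ?thesis using a by auto
  next
    case False
    then have "\<bar>t - UU \<rho> \<psi> v\<bar> < width v"
      using Kt_nonzero a(1) by simp
    moreover have "2 * \<bar>UU \<rho> (psi2 \<rho> \<psi> t v) v\<bar> < 1 - \<rho>"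
      using abs_UU_less a(1,10) by simp
    ultimately show ?thesis
      using a(9-12) unfolding area2_def by (intro conjI; linarith)
  qed
  then show "0 < area2 \<rho> \<psi> t v" "\<rho> + area2 \<rho> \<psi> t v < 3 / 2" by auto
qed

lemma cos_half_nonneg: "- pi \<le> \<psi> \<Longrightarrow> \<psi> \<le> pi \<Longrightarrow> cos (\<psi> / 2) \<ge> 0"
  by (intro cos_ge_zero) auto

text \<open>At the unwanted crossing both angles \<open>tau\<close> are within \<open>2 / (9 v\<^sup>2)\<close> of \<open>0\<close> or \<open>\<pi>\<close>, which would force
  \<open>\<theta> - \<theta>'\<close> into a \<open>1 / v\<^sup>2\<close>-neighbourhood of an odd multiple of \<open>\<pi>\<close>.\<close>

lemma no_collision_aux:
  assumes adm: "admissible \<rho> \<theta> t c v" "admissible \<rho> \<theta>' t' c' v"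
    and \<psi>: "- pi \<le> \<psi>" "\<psi> \<le> pi" "- pi \<le> \<psi>'" "\<psi>' \<le> pi"
    and j: "psi2 \<rho> \<psi> t v = psi2 \<rho> \<psi>' t' v + 2 * pi + 4 * pi * of_int i"
    and A: "area2 \<rho> \<psi> t v = area2 \<rho> \<psi>' t' v"
    and k: "theta2 \<rho> \<theta> \<psi> t v = theta2 \<rho> \<theta>' \<psi>' t' v + 2 * pi * of_int k"
    and travel: "Kt (t - UU \<rho> \<psi> v) v \<noteq> 0"
  shows False
proof -
  note a = admissibleD[OF adm(1)] and a' = admissibleD[OF adm(2)]
  define T where "T = 2 / (9 * v\<^sup>2)"
  define \<sigma> \<sigma>' where "\<sigma> = psi2 \<rho> \<psi> t v" and "\<sigma>' = psi2 \<rho> \<psi>' t' v"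
  have U: "UU \<rho> \<sigma> v = - UU \<rho> \<sigma>' v" and tau: "tau \<sigma> v = pi - tau \<sigma>' v"
    using bend_antiperiodic[OF a(1)] bend_periodic j unfolding \<sigma>_def \<sigma>'_def by auto
  have tr: "\<bar>t - UU \<rho> \<psi> v\<bar> < width v"
    using Kt_nonzero[OF travel] a(1) by simp
  then have "8 * \<bar>UU \<rho> \<psi> v\<bar> \<le> 1 - \<rho>"
    using a(4,5,12) by linarith
  from tau_near_0_pi(1)[OF a(1,10) this cos_half_nonneg[OF \<psi>(1,2)]]
  have t0: "tau \<psi> v \<le> T" by (simp add: T_def)
  have eq: "t - UU \<rho> \<psi> v + UU \<rho> \<sigma> v = t' - UU \<rho> \<psi>' v + UU \<rho> \<sigma>' v"
    using A by (simp add: area2_def \<sigma>_def \<sigma>'_def)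
  \<comment> \<open>The second point is near a crossing as well. If it does not travel then
    \<open>\<sigma>' = \<psi>'\<close>; if it does, \<open>2 * UU \<rho> \<sigma> v\<close> is the
    difference of two offsets below \<open>width v\<close>.\<close>
  have "8 * \<bar>UU \<rho> \<psi>' v\<bar> \<le> 1 - \<rho> \<and> 8 * \<bar>UU \<rho> \<sigma> v\<bar> \<le> 1 - \<rho>"
  proof (cases "Kt (t' - UU \<rho> \<psi>' v) v = 0")
    case True
    then have "\<sigma>' = \<psi>'" by (simp add: \<sigma>'_def psi2_def)
    then show ?thesis using eq tr U a(4,5,12) a'(4,5) by (simp; linarith)
  next
    case False
    then have "\<bar>t' - UU \<rho> \<psi>' v\<bar> < width v"
      using Kt_nonzero a(1) by simp
    then show ?thesis using eq tr U a(4,5,12) a'(4,5) by linarith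
  qed
  then have U': "8 * \<bar>UU \<rho> \<psi>' v\<bar> \<le> 1 - \<rho>" "8 * \<bar>UU \<rho> \<sigma> v\<bar> \<le> 1 - \<rho>" by auto
  have t0': "tau \<psi>' v \<le> T"
    using tau_near_0_pi(1)[OF a(1,10) U'(1) cos_half_nonneg[OF \<psi>(3,4)]] by (simp add: T_def)
  have t1: "tau \<sigma> v \<le> T \<or> pi - tau \<sigma> v \<le> T"
    using tau_near_0_pi[OF a(1,10) U'(2)] unfolding T_def by (meson linear)
  have pos: "0 < tau \<psi> v" "0 < tau \<psi>' v" "0 < tau \<sigma> v" "tau \<sigma> v < pi"
    using tau_bounds[OF a(1)] by auto
  have th: "\<theta> - \<theta>' = tau \<psi> v - tau \<psi>' v + pi - 2 * tau \<sigma> v + 2 * pi * of_int k"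
    using k tau unfolding theta2_def \<sigma>_def \<sigma>'_def by simp
  define e where "e = 1 / v\<^sup>2"
  \<comment> \<open>The difference of the first two angles contributes at most \<open>T\<close> and
    the doubled angle \<open>2 * T\<close>; the total stays below the gap \<open>e\<close>.\<close>
  have e: "3 * T < e"
    using a(1) by (simp add: T_def e_def field_simps)
  have r: "\<bar>\<theta> - \<theta>'\<bar> < pi - e"
    using a(6,7) a'(6,7) unfolding e_def by (simp add: abs_less_iff)
  have odd: "pi \<le> \<bar>pi + 2 * pi * of_int l\<bar>" for l :: int
  proof -
    have "1 + 2 * l \<noteq> 0" by presburger
    then have "1 \<le> \<bar>1 + 2 * l\<bar>" by linarith
    then have "real_of_int 1 \<le> real_of_int \<bar>1 + 2 * l\<bar>"
      by (simp only: of_int_le_iff)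
    then have "1 \<le> \<bar>1 + 2 * real_of_int l\<bar>" by simp
    then have "pi * 1 \<le> pi * \<bar>1 + 2 * real_of_int l\<bar>"
      by (intro mult_left_mono) auto
    also have "\<dots> = \<bar>pi * (1 + 2 * real_of_int l)\<bar>"
      by (simp add: abs_mult)
    finally show ?thesis by (simp add: algebra_simps)
  qed
  show False
    using t1
  proof
    assume "tau \<sigma> v \<le> T"
    then show False using th r e odd[of k] t0 t0' pos by linarith
  next
    assume "pi - tau \<sigma> v \<le> T"
    \<comment> \<open>For an angle near \<open>pi\<close> the term
      \<open>- 2 * tau \<sigma> v\<close> lowers the odd multiple of \<open>pi\<close> to the
      previous one.\<close>
    moreover have "pi + 2 * pi * of_int (k - 1) = 2 * pi * of_int k - pi"
      by (simp add: algebra_simps)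
    ultimately show False using th r e odd[of "k - 1"] t0 t0' pos by linarith
  qed
qed

text \<open>The second curve closes up after \<open>4 * pi\<close>, so the parity of
  \<open>j\<close> matters. For even \<open>j\<close> all bending terms at the end points agree and
  the steps can be undone. For odd \<open>j\<close> neither point travels by
  \<open>no_collision_aux\<close>, and two angles in one window of length \<open>2 * pi\<close>
  cannot differ by an odd multiple of \<open>2 * pi\<close>.\<close>

lemma chart_inj:
  assumes adm: "admissible \<rho> \<theta> t c v" "admissible \<rho> \<theta>' t' c' v"
    and \<psi>: "- pi \<le> \<psi>" "\<psi> < pi" "- pi \<le> \<psi>'" "\<psi>' < pi"
    and j: "psi2 \<rho> \<psi> t v = psi2 \<rho> \<psi>' t' v + 2 * pi * of_int j"
    and A: "area2 \<rho> \<psi> t v = area2 \<rho> \<psi>' t' v"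
    and k: "theta2 \<rho> \<theta> \<psi> t v = theta2 \<rho> \<theta>' \<psi>' t' v + 2 * pi * of_int k"
    and c: "c2 \<rho> c \<psi> t v - of_int m = c2 \<rho> c' \<psi>' t' v - of_int m'"
  shows "\<theta> = \<theta>' \<and> t = t' \<and> \<psi> = \<psi>' \<and> m = m' \<and> c = c'"
proof (cases "even j")
  case True
  note a = admissibleD[OF adm(1)] and a' = admissibleD[OF adm(2)]
  from True obtain i where i: "j = 2 * i" by auto
  have j': "psi2 \<rho> \<psi> t v = psi2 \<rho> \<psi>' t' v + 4 * pi * of_int i"
    using j i by simp
  define \<sigma> \<sigma>' where "\<sigma> = psi2 \<rho> \<psi> t v" and "\<sigma>' = psi2 \<rho> \<psi>' t' v"
  have p: "UU \<rho> \<sigma> v = UU \<rho> \<sigma>' v" "tau \<sigma> v = tau \<sigma>' v" "VV \<rho> \<sigma> v = VV \<rho> \<sigma>' v"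
    using bend_periodic j' unfolding \<sigma>_def \<sigma>'_def by auto
  have t: "t - UU \<rho> \<psi> v = t' - UU \<rho> \<psi>' v"
    using A p by (simp add: area2_def \<sigma>_def \<sigma>'_def)
  have small: "l = 0" if "\<bar>x\<bar> < 2 * pi" "x = 2 * pi * of_int l" for x and l :: int
  proof -
    have "2 * pi * \<bar>real_of_int l\<bar> < 2 * pi * 1"
      using that by (simp add: abs_mult)
    then have "\<bar>real_of_int l\<bar> < 1" by simp
    then show ?thesis by linarith
  qed
  have "\<psi> - \<psi>' = 2 * pi * of_int (2 * i)"
    using j' t unfolding psi2_def by simp
  moreover have "\<bar>\<psi> - \<psi>'\<bar> < 2 * pi"
    using \<psi> by linarith
  ultimately have "i = 0" using small by fastforce
  then have \<psi>\<psi>: "\<psi> = \<psi>'" using \<open>\<psi> - \<psi>' = _\<close> by simp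
  have tt: "t = t'" using t \<psi>\<psi> by simp
  have "\<theta> - \<theta>' = 2 * pi * of_int k"
    using k p \<psi>\<psi> unfolding theta2_def \<sigma>_def \<sigma>'_def by simp
  moreover have "0 < 1 / (2 * v\<^sup>2)" using a(1) by simp
  then have "\<bar>\<theta> - \<theta>'\<bar> < 2 * pi"
    using a(6,7) a'(6,7) pi_gt_zero by linarith
  ultimately have "k = 0" using small by blast
  then have \<theta>: "\<theta> = \<theta>'" using \<open>\<theta> - \<theta>' = _\<close> by simp
  have "c - c' = of_int (m - m')"
    using c \<psi>\<psi> tt unfolding c2_def by simp
  \<comment> \<open>The strip \<open>|c| < 1 / 2\<close> has width one, so different turns cannot
    give the same value.\<close>
  then have "\<bar>real_of_int (m - m')\<bar> < 1"
    using a(8) a'(8) by linarith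
  then have "m = m'" by linarith
  then show ?thesis using \<psi>\<psi> tt \<theta> \<open>c - c' = _\<close> by simp
next
  case False
  then obtain i where i: "j = 2 * i + 1" by (rule oddE)
  have j': "psi2 \<rho> \<psi> t v = psi2 \<rho> \<psi>' t' v + 2 * pi + 4 * pi * of_int i"
    using j i by (simp add: algebra_simps)
  have j'': "psi2 \<rho> \<psi>' t' v = psi2 \<rho> \<psi> t v + 2 * pi + 4 * pi * of_int (- i - 1)"
    using j' by (simp add: algebra_simps)
  have k'': "theta2 \<rho> \<theta>' \<psi>' t' v = theta2 \<rho> \<theta> \<psi> t v + 2 * pi * of_int (- k)"
    using k by simp
  have "Kt (t - UU \<rho> \<psi> v) v = 0"
    using no_collision_aux[OF adm _ _ _ _ j' A k] \<psi> by force
  moreover have "Kt (t' - UU \<rho> \<psi>' v) v = 0"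
    using no_collision_aux[OF adm(2,1) _ _ _ _ j'' A[symmetric] k''] \<psi> by force
  ultimately have "\<psi> - \<psi>' = 2 * pi * of_int j"
    using j by (simp add: psi2_def)
  then have "\<bar>2 * pi * of_int j\<bar> < 2 * pi"
    using \<psi> by linarith
  then have "2 * pi * \<bar>real_of_int j\<bar> < 2 * pi * 1"
    by (simp add: abs_mult)
  then have "\<bar>real_of_int j\<bar> < 1" by simp
  then have "j = 0" by linarith
  with False show ?thesis by simp
qed

text \<open>Away from the crossing the travelling Hamiltonian is locally constant, so that consecutive charts agree.\<close>

lemma chart_overlap:
  assumes adm: "admissible \<rho> \<theta> t c v" and \<psi>: "pi / 2 \<le> \<psi>" "\<psi> \<le> 3 * pi / 2"
  shows "psi2 \<rho> \<psi> t v = psi2 \<rho> (\<psi> - 2 * pi) t v + 2 * pi" "area2 \<rho> \<psi> t v = area2 \<rho> (\<psi> - 2 * pi) t v"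
    "theta2 \<rho> \<theta> \<psi> t v = theta2 \<rho> \<theta> (\<psi> - 2 * pi) t v" "c2 \<rho> c \<psi> t v = c2 \<rho> c (\<psi> - 2 * pi) t v - 1"
proof -
  note a = admissibleD[OF adm]
  let ?s = "sqrt (1 - (wS \<psi> v)\<^sup>2)"
  have s: "0 < ?s" "?s \<le> 1" using wS_square_less_1[OF a(1)] by auto
  have "sin (\<psi> / 2) \<ge> 1 / 2"
  proof -
    have "cos (pi / 3) \<le> cos \<bar>\<psi> / 2 - pi / 2\<bar>"
      using \<psi> by (intro cos_monotone_0_pi_le) linarith+
    then show ?thesis by (simp add: cos_60 cos_diff)
  qed
  then have "199 / 200 * (1 / 2) \<le> rr v * sin (\<psi> / 2)"
    using rr_bounds(1)[OF a(1)] by (intro mult_mono) auto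
  then have "1 / 4 \<le> rr v * sin (\<psi> / 2)" by simp
  also have "\<dots> \<le> rr v * sin (\<psi> / 2) / ?s"
    using s \<open>1 / 4 \<le> _\<close> by (simp add: le_divide_eq mult_left_le)
  finally have "(1 - \<rho>) / 2 * (1 / 4) \<le> (1 - \<rho>) / 2 * (rr v * sin (\<psi> / 2) / ?s)"
    using a(10) by (intro mult_left_mono) auto
  \<comment> \<open>At these angles the second curve is at least \<open>(1 - \<rho>) / 8\<close>
    away from the base circle, while \<open>t\<close> and \<open>width v\<close> are below
    \<open>(1 - \<rho>) / 16\<close>. So the strand lies outside the transition zone, and on
    opposite sides for the two charts.\<close>
  then have U: "1 - \<rho> \<le> 8 * UU \<rho> \<psi> v"
    unfolding UU_alt by simp
  have U': "UU \<rho> (\<psi> - 2 * pi) v = - UU \<rho> \<psi> v"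
    using bend_antiperiodic(2)[OF a(1), of \<rho> "\<psi> - 2 * pi"] by simp
  have "t - UU \<rho> \<psi> v \<le> - (width v)" "t - UU \<rho> (\<psi> - 2 * pi) v \<ge> width v"
    using U U' a(4,5,12) by linarith+
  then have "64 * v * (t - UU \<rho> \<psi> v) \<le> - 1" "64 * v * (t - UU \<rho> (\<psi> - 2 * pi) v) \<ge> 1"
    using a(1) by (simp_all add: width_def field_simps)
  note K = Kt_Kv_trivial'[OF this(1)] Kt_Kv_trivial[OF this(2)]
  show "psi2 \<rho> \<psi> t v = psi2 \<rho> (\<psi> - 2 * pi) t v + 2 * pi" "area2 \<rho> \<psi> t v = area2 \<rho> (\<psi> - 2 * pi) t v"
    "theta2 \<rho> \<theta> \<psi> t v = theta2 \<rho> \<theta> (\<psi> - 2 * pi) t v" "c2 \<rho> c \<psi> t v = c2 \<rho> c (\<psi> - 2 * pi) t v - 1"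
    by (simp_all add: psi2_def area2_def theta2_def c2_def K)
qed

section \<open>Area of disc segments and polar coordinates\<close>

text \<open>The area of the part of the unit disc to the left of the vertical line through \<open>x\<close>.\<close>

definition disc_area :: "real \<Rightarrow> real" where
  "disc_area x = x * sqrt (1 - x\<^sup>2) + arcsin x + pi / 2"

text \<open>Since \<open>arcsin x + pi / 2 = arccos (- x)\<close> is at least its own sine
  \<open>sqrt (1 - x^2)\<close>, the area is at least \<open>sqrt (1 - x^2) * (1 + x)\<close>, which
  dominates half the square of \<open>1 - x^2\<close>. Reflection by \<open>disc_area_minus\<close>
  yields the upper bound.\<close>

lemma disc_area_lower:
  assumes "\<bar>x\<bar> < 1" "1 / v < 1 - x\<^sup>2" "v > 0"
  shows "1 / (2 * v\<^sup>2) < disc_area x"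
proof -
  let ?s = "1 - x\<^sup>2"
  have x: "- 1 \<le> x" "x \<le> 1" using assms(1) by auto
  have s: "0 < ?s" "?s \<le> 1" using assms(1) by (auto simp: abs_square_less_1)
  have "sin (arccos (- x)) \<le> arccos (- x)"
    using arccos_lbound[of "- x"] x by (intro sin_x_le_x) auto
  moreover have "sin (arccos (- x)) = sqrt ?s"
    using sin_arccos_abs[of "- x"] x by simp
  moreover have "arccos (- x) = arcsin x + pi / 2"
    using x by (simp add: arccos_minus_abs arcsin_arccos_eq)
  ultimately have "sqrt ?s * (1 + x) \<le> disc_area x"
    unfolding disc_area_def by (simp add: algebra_simps)
  moreover have "?s * (?s / 2) \<le> sqrt ?s * (1 + x)"
  proof (rule mult_mono)
    have "?s * ?s \<le> ?s * 1" using s by (intro mult_left_mono) auto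
    then have "?s\<^sup>2 \<le> ?s" by (simp only: power2_eq_square mult_1_right)
    then show "?s \<le> sqrt ?s" by (rule real_le_rsqrt)
    have "(1 + x) * (1 - x) \<le> (1 + x) * 2"
      using x by (intro mult_left_mono) auto
    then show "?s / 2 \<le> 1 + x" by (simp add: power2_eq_square algebra_simps)
  qed (use s in auto)
  moreover have "1 / v * (1 / v) < ?s * ?s"
    using assms(2,3) s by (intro mult_strict_mono) auto
  then have "1 / (2 * v\<^sup>2) < ?s * (?s / 2)"
    by (simp add: power2_eq_square)
  ultimately show ?thesis by linarith
qed

lemma disc_area_minus: "\<bar>x\<bar> < 1 \<Longrightarrow> disc_area (- x) = pi - disc_area x"
  by (simp add: disc_area_def arcsin_minus)

lemma DERIV_disc_area:
  assumes "\<bar>x\<bar> < 1"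
  shows "(disc_area has_real_derivative 2 * sqrt (1 - x\<^sup>2)) (at x)"
proof -
  have x2: "x\<^sup>2 < 1" using assms by (simp add: abs_square_less_1)
  define s where "s = sqrt (1 - x\<^sup>2)"
  have s: "s > 0" "s * s = 1 - x\<^sup>2" using x2 by (auto simp: s_def)
  have s': "((\<lambda>x. sqrt (1 - x\<^sup>2)) has_real_derivative - x / s) (at x)"
    unfolding s_def using x2 by (auto intro!: derivative_eq_intros simp: field_simps)
  have "((\<lambda>x. x * sqrt (1 - x\<^sup>2) + arcsin x + pi / 2) has_real_derivative
      (1 * s + - x / s * x + inverse s + 0)) (at x)"
    unfolding s_def
    by (intro DERIV_add DERIV_mult DERIV_ident DERIV_arcsin DERIV_const s'[unfolded s_def]) (use assms in auto)
  also have "1 * s + - x / s * x + inverse s + 0 = 2 * s"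
    using s by (simp add: field_simps power2_eq_square)
  finally show ?thesis by (simp add: disc_area_def[abs_def] s_def)
qed

lemma disc_area_inj:
  assumes "\<bar>x\<bar> < 1" "\<bar>y\<bar> < 1" "disc_area x = disc_area y"
  shows "x = y"
proof -
  have "disc_area x < disc_area y" if "x < y" "\<bar>x\<bar> < 1" "\<bar>y\<bar> < 1" for x y
  proof (rule DERIV_pos_imp_increasing[OF that(1)])
    fix z assume "x \<le> z" "z \<le> y"
    then have z: "\<bar>z\<bar> < 1" using that by auto
    then show "\<exists>d. (disc_area has_real_derivative d) (at z) \<and> 0 < d"
      using DERIV_disc_area[OF z] abs_square_less_1[of z] by (intro exI conjI) auto
  qed
  then show ?thesis using assms by (metis linorder_neqE_linordered_idom less_irrefl)
qed

lemma polar_norm_square: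
  assumes "r > 0"
  shows "(sqrt (2 * r) * cos t)\<^sup>2 + (sqrt (2 * r) * sin t)\<^sup>2 = 2 * r"
proof -
  have "(sqrt (2 * r) * cos t)\<^sup>2 + (sqrt (2 * r) * sin t)\<^sup>2 = (sqrt (2 * r))\<^sup>2 * ((sin t)\<^sup>2 + (cos t)\<^sup>2)"
    by (simp only: power_mult_distrib) (simp only: algebra_simps)
  then show ?thesis using assms by simp
qed

lemma polar_inj:
  assumes "0 < r" "0 < r'" "sqrt (2 * r) * cos t = sqrt (2 * r') * cos t'" "sqrt (2 * r) * sin t = sqrt (2 * r') * sin t'"
  shows "r = r' \<and> (\<exists>k::int. t = t' + 2 * pi * of_int k)"
proof -
  have r: "r = r'" using polar_norm_square[OF assms(1), of t] polar_norm_square[OF assms(2), of t'] assms(3,4) by simp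
  then have "cos t = cos t'" "sin t = sin t'" using assms by auto
  then show ?thesis using r sin_cos_eq_iff[of t t'] by auto
qed


section \<open>Smoothness of the building blocks\<close>

lemma C_inf_on_disc_area:
  assumes "open S" "C_inf_on S f" "\<And>x. x \<in> S \<Longrightarrow> \<bar>f x\<bar> < 1"
  shows "C_inf_on S (\<lambda>x. disc_area (f x))"
proof -
  have "1 - (f x)\<^sup>2 > 0" if "x \<in> S" for x
    using assms(3)[OF that] by (simp add: abs_square_less_1)
  then show ?thesis
    unfolding disc_area_def
    by (intro C_inf_on_add C_inf_on_mult C_inf_on_sqrt C_inf_on_diff C_inf_on_power C_inf_on_const C_inf_on_arcsin assms)
qed

lemma C_inf_on_bend:
  assumes "open S" "C_inf_on S \<rho>" "C_inf_on S \<psi>" "C_inf_on S v" "\<And>x. x \<in> S \<Longrightarrow> v x > 1"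
  shows "C_inf_on S (\<lambda>x. tau (\<psi> x) (v x))" "C_inf_on S (\<lambda>x. UU (\<rho> x) (\<psi> x) (v x))"
    "C_inf_on S (\<lambda>x. VV (\<rho> x) (\<psi> x) (v x))"
proof -
  have v0: "200 * v x ^ 4 \<noteq> 0" "50 * v x ^ 5 \<noteq> 0" if "x \<in> S" for x
    using assms(5)[OF that] by auto
  note h = assms(1-4) C_inf_on_add C_inf_on_diff C_inf_on_mult C_inf_on_divide C_inf_on_power C_inf_on_const
    C_inf_on_sin C_inf_on_cos
  have r: "C_inf_on S (\<lambda>x. rr (v x))" "C_inf_on S (\<lambda>x. rr1 (v x))"
    unfolding rr_def rr1_def by (intro h v0; assumption)+
  have w: "C_inf_on S (\<lambda>x. wS (\<psi> x) (v x))" "C_inf_on S (\<lambda>x. wS1 (\<psi> x) (v x))" "C_inf_on S (\<lambda>x. wS2 (\<psi> x) (v x))"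
    unfolding wS_def wS1_def wS2_def by (intro h r; simp)+
  have less: "\<bar>wS (\<psi> x) (v x)\<bar> < 1" "1 - (wS (\<psi> x) (v x))\<^sup>2 > 0" if "x \<in> S" for x
    using abs_wS_less_1[OF assms(5)[OF that]] wS_square_less_1[OF assms(5)[OF that]] by auto
  have i: "C_inf_on S (\<lambda>x. isq (wS (\<psi> x) (v x)))"
    unfolding isq_def
    by (intro h w C_inf_on_inverse C_inf_on_sqrt less) (use less(2) in force)+
  show "C_inf_on S (\<lambda>x. tau (\<psi> x) (v x))"
    unfolding tau_def by (intro C_inf_on_arccos w less assms(1))
  show "C_inf_on S (\<lambda>x. UU (\<rho> x) (\<psi> x) (v x))" "C_inf_on S (\<lambda>x. VV (\<rho> x) (\<psi> x) (v x))"
    unfolding UU_def VV_def by (intro h w i)+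
qed

lemma C_inf_on_travel:
  assumes "open S" "C_inf_on S t" "C_inf_on S v"
  shows "C_inf_on S (\<lambda>x. Kt (t x) (v x))" "C_inf_on S (\<lambda>x. Kv (t x) (v x))"
proof -
  have arg: "C_inf_on S (\<lambda>x. 64 * v x * t x)"
    by (intro C_inf_on_mult C_inf_on_const assms)
  have s: "C_inf_on S (\<lambda>x. smooth_step (64 * v x * t x))" "C_inf_on S (\<lambda>x. smooth_step' (64 * v x * t x))"
    by (rule C_inf_on_compose_real[OF assms(1) arg C_inf_on_smooth_step] C_inf_on_compose_real[OF assms(1) arg C_inf_on_smooth_step'], simp)+
  show "C_inf_on S (\<lambda>x. Kt (t x) (v x))" "C_inf_on S (\<lambda>x. Kv (t x) (v x))"
    unfolding Kt_def Kv_def by (intro C_inf_on_mult C_inf_on_add C_inf_on_power C_inf_on_const s assms)+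
qed

section \<open>The embedding\<close>

locale three_planes =
  fixes a b c :: "'n::finite"
  assumes distinct: "a \<noteq> b" "a \<noteq> c" "b \<noteq> c"
begin

abbreviation xa :: "(real^'n) \<times> (real^'n) \<Rightarrow> real" where "xa p \<equiv> fst p $ a"
abbreviation ya :: "(real^'n) \<times> (real^'n) \<Rightarrow> real" where "ya p \<equiv> snd p $ a"
abbreviation xb :: "(real^'n) \<times> (real^'n) \<Rightarrow> real" where "xb p \<equiv> fst p $ b"
abbreviation yb :: "(real^'n) \<times> (real^'n) \<Rightarrow> real" where "yb p \<equiv> snd p $ b"
abbreviation xc :: "(real^'n) \<times> (real^'n) \<Rightarrow> real" where "xc p \<equiv> fst p $ c"
abbreviation yc :: "(real^'n) \<times> (real^'n) \<Rightarrow> real" where "yc p \<equiv> snd p $ c"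

abbreviation Z :: "((real^'n) \<times> (real^'n)) set" where "Z \<equiv> cylinder a 1"

section \<open>Symplectic coordinates on the cylinder\<close>

definition \<Omega> :: "(real^'n) \<times> (real^'n) \<Rightarrow> (real^'n) \<times> (real^'n) \<Rightarrow> real" where
  "\<Omega> u v = (xa u * ya v - xa v * ya u) + (xb u * yb v - xb v * yb u) + (xc u * yc v - xc v * yc u)"

text \<open>\<open>(q0, s0)\<close> maps the \<open>b\<close>-plane to the half-plane
  \<open>q0 > 0\<close>, and \<open>(c0, v0)\<close> maps the \<open>c\<close>-plane into the strip
  \<open>|c0| < 1 / 2\<close>, \<open>v0 > 0\<close>. Here \<open>v0\<close> is
  \<open>exp (yc p)\<close> divided by the derivative of \<open>arctan / 4\<close> at
  \<open>e0 p\<close>, which keeps the map symplectic.\<close>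

definition q0 :: "(real^'n) \<times> (real^'n) \<Rightarrow> real" where "q0 p = exp (xb p)"
definition s0 :: "(real^'n) \<times> (real^'n) \<Rightarrow> real" where "s0 p = yb p * exp (- xb p)"
definition e0 :: "(real^'n) \<times> (real^'n) \<Rightarrow> real" where "e0 p = xc p * exp (- yc p)"
definition c0 :: "(real^'n) \<times> (real^'n) \<Rightarrow> real" where "c0 p = arctan (e0 p) / 4"
definition v0 :: "(real^'n) \<times> (real^'n) \<Rightarrow> real" where "v0 p = 4 * (1 + (e0 p)\<^sup>2) * exp (yc p)"

definition N :: "(real^'n) \<times> (real^'n) \<Rightarrow> real" where "N p = (xa p)\<^sup>2 + (ya p)\<^sup>2"
definition \<alpha> :: "(real^'n) \<times> (real^'n) \<Rightarrow> real" where "\<alpha> p = - 2 / (1 - N p)\<^sup>2 * (s0 p - c0 p)"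
definition x1 :: "(real^'n) \<times> (real^'n) \<Rightarrow> real" where "x1 p = cos (\<alpha> p) * xa p - sin (\<alpha> p) * ya p"
definition y1 :: "(real^'n) \<times> (real^'n) \<Rightarrow> real" where "y1 p = sin (\<alpha> p) * xa p + cos (\<alpha> p) * ya p"
definition q1 :: "(real^'n) \<times> (real^'n) \<Rightarrow> real" where "q1 p = q0 p + 1 / (1 - N p)"
definition v1 :: "(real^'n) \<times> (real^'n) \<Rightarrow> real" where "v1 p = v0 p + 1 / (1 - N p)"

text \<open>Each vertical chord of the disc is rescaled to the unit interval with reversed
  direction, while \<open>\<theta>\<close> is the area to its left. So the disc becomes the
  rectangle \<open>0 < \<rho> < 1\<close>, \<open>0 < \<theta> < pi\<close>.\<close>

definition \<rho> :: "(real^'n) \<times> (real^'n) \<Rightarrow> real" where "\<rho> p = (1 - y1 p / sqrt (1 - (x1 p)\<^sup>2)) / 2"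
definition \<theta> :: "(real^'n) \<times> (real^'n) \<Rightarrow> real" where "\<theta> p = disc_area (x1 p)"
text \<open>Inverting \<open>q1\<close> turns large values into a small transversal coordinate. The
  conjugate variable \<open>\<phi>\<close> is unbounded and serves as the unwrapped angle along the
  annulus.\<close>

definition t1 :: "(real^'n) \<times> (real^'n) \<Rightarrow> real" where "t1 p = 1 / (64 * q1 p)"
definition \<phi> :: "(real^'n) \<times> (real^'n) \<Rightarrow> real" where "\<phi> p = - 64 * (q1 p)\<^sup>2 * s0 p"

lemma N_rotate: "(x1 p)\<^sup>2 + (y1 p)\<^sup>2 = N p"
proof -
  have "(x1 p)\<^sup>2 + (y1 p)\<^sup>2 = ((cos (\<alpha> p))\<^sup>2 + (sin (\<alpha> p))\<^sup>2) * ((xa p)\<^sup>2 + (ya p)\<^sup>2)"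
    unfolding x1_def y1_def by algebra
  then show ?thesis by (simp add: N_def)
qed

lemma open_Z: "open Z"
proof -
  have "Z = {p. (fst p $ a)\<^sup>2 + (snd p $ a)\<^sup>2 < 1}"
    by (auto simp: cylinder_def)
  also have "open \<dots>"
    by (intro open_Collect_less continuous_intros)
  finally show ?thesis .
qed

lemma Z_iff: "p \<in> Z \<longleftrightarrow> N p < 1"
  by (cases p) (simp add: cylinder_def N_def)

context
  fixes p :: "(real^'n) \<times> (real^'n)"
  assumes p: "p \<in> Z"
begin

lemma N_less_1: "N p < 1" "0 \<le> N p"
  using p Z_iff by (auto simp: N_def)

lemma x1_less_1: "\<bar>x1 p\<bar> < 1" "1 - N p \<le> 1 - (x1 p)\<^sup>2" "0 < 1 - (x1 p)\<^sup>2"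
proof -
  show "1 - N p \<le> 1 - (x1 p)\<^sup>2" using N_rotate[of p] zero_le_power2[of "y1 p"] by linarith
  then show "0 < 1 - (x1 p)\<^sup>2" using N_less_1 by linarith
  then show "\<bar>x1 p\<bar> < 1" by (simp add: abs_square_less_1)
qed

lemma inverse_1_minus_N: "1 / (1 - N p) \<ge> 1"
  using N_less_1 by simp

lemma q1_gt: "q1 p > 1 / (1 - N p)" "q1 p > 1" and v1_gt: "v1 p > 1 / (1 - N p)" "v1 p > 1"
proof -
  have "0 < 4 * (1 + (e0 p)\<^sup>2) * exp (yc p)"
    by (simp add: add_pos_nonneg)
  then show q: "q1 p > 1 / (1 - N p)" and v: "v1 p > 1 / (1 - N p)"
    by (simp_all add: q1_def v1_def q0_def v0_def)
  show "q1 p > 1" "v1 p > 1" using q v inverse_1_minus_N by linarith+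
qed

text \<open>From \<open>(y1 p)^2 \<le> N p * (1 - (x1 p)^2)\<close> the quotient \<open>h\<close>
  satisfies \<open>|h| \<le> sqrt (N p)\<close>, so its distance from \<open>1\<close> and
  \<open>-1\<close> is at least \<open>(1 - N p) / 2\<close>. Applied both to \<open>q1 p\<close>
  and to \<open>v1 p\<close>.\<close>

lemma \<rho>_bound:
  assumes "w > 1 / (1 - N p)"
  shows "1 / (4 * w) < \<rho> p" "\<rho> p < 1 - 1 / (4 * w)"
proof -
  define h where "h = y1 p / sqrt (1 - (x1 p)\<^sup>2)"
  define n where "n = sqrt (N p)"
  have n: "0 \<le> n" "n < 1" "n\<^sup>2 = N p" using N_less_1 by (auto simp: n_def)
  have s: "1 - (x1 p)\<^sup>2 > 0" by (rule x1_less_1)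
  have w0: "w > 0" using assms inverse_1_minus_N by linarith
  have w1: "1 / w < 1 - N p"
    using assms N_less_1 w0 by (simp add: pos_divide_less_eq mult.commute)
  have "(y1 p)\<^sup>2 = N p - (x1 p)\<^sup>2" using N_rotate[of p] by simp
  also have "\<dots> \<le> N p * (1 - (x1 p)\<^sup>2)"
    using N_less_1 mult_right_le_one_le[of "(x1 p)\<^sup>2" "N p"] by (simp add: algebra_simps)
  finally have "h\<^sup>2 \<le> n\<^sup>2"
    using s by (simp add: h_def n power_divide divide_le_eq)
  then have hn: "\<bar>h\<bar> \<le> n" using n(1) abs_le_square_iff[of h n] by simp
  have "1 - N p = (1 - n) * (1 + n)" using n(3) by (simp add: power2_eq_square algebra_simps)
  also have "\<dots> \<le> (1 - n) * 2" using n by (intro mult_left_mono) auto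
  finally have "1 - N p \<le> 2 - 2 * n" by simp
  moreover have "h \<le> n" "- h \<le> n" using hn by auto
  ultimately have "1 / w < 2 - 2 * h" "1 / w < 2 + 2 * h" using w1 by linarith+
  moreover have "1 / (4 * w) = 1 / w / 4" by simp
  moreover have "\<rho> p = 1 / 2 - h / 2" by (simp add: \<rho>_def h_def diff_divide_distrib)
  ultimately show "1 / (4 * w) < \<rho> p" "\<rho> p < 1 - 1 / (4 * w)" by linarith+
qed

lemma admissible_base: "admissible (\<rho> p) (\<theta> p) (t1 p) (c0 p) (v1 p)"
proof -
  have v: "1 / v1 p < 1 - N p"
    using v1_gt N_less_1 by (simp add: field_simps)
  have \<theta>: "1 / (2 * (v1 p)\<^sup>2) < disc_area (x1 p)" "1 / (2 * (v1 p)\<^sup>2) < disc_area (- x1 p)"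
    using disc_area_lower[of "x1 p" "v1 p"] disc_area_lower[of "- x1 p" "v1 p"] v x1_less_1 v1_gt by auto
  have t: "16 * t1 p = 1 / (4 * q1 p)" by (simp add: t1_def)
  have c: "\<bar>c0 p\<bar> < 1 / 2"
    using arctan_bounded[of "e0 p"] pi_less_4 by (auto simp: c0_def abs_less_iff)
  show ?thesis
    unfolding admissible_def
    using \<rho>_bound[OF v1_gt(1)] \<rho>_bound[OF q1_gt(1)] v1_gt(2) q1_gt(2) t c \<theta> disc_area_minus[OF x1_less_1(1)]
    by (simp add: \<theta>_def t1_def)
qed

end

lemma C_inf_on_coord: "C_inf_on S (\<lambda>p :: (real^'n) \<times> (real^'n). fst p $ i)" "C_inf_on S (\<lambda>p :: (real^'n) \<times> (real^'n). snd p $ i)"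
  if "open S"
  by (rule C_inf_on_bounded_linear[OF that];
      rule bounded_linear_compose[OF bounded_linear_vec_nth, OF bounded_linear_fst, unfolded o_def]
        bounded_linear_compose[OF bounded_linear_vec_nth, OF bounded_linear_snd, unfolded o_def])+

lemma C_inf_base:
  "C_inf_on Z \<rho>" "C_inf_on Z \<theta>" "C_inf_on Z t1" "C_inf_on Z \<phi>" "C_inf_on Z c0" "C_inf_on Z v1"
proof -
  note h = open_Z C_inf_on_coord[OF open_Z] C_inf_on_add C_inf_on_diff C_inf_on_mult C_inf_on_uminus C_inf_on_divide
    C_inf_on_power C_inf_on_const C_inf_on_sin C_inf_on_cos C_inf_on_exp C_inf_on_arctan
  have nz: "1 - N p \<noteq> 0" "(1 - N p)\<^sup>2 \<noteq> 0" if "p \<in> Z" for p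
    using N_less_1[OF that] by auto
  have s: "1 - (x1 p)\<^sup>2 > 0" "sqrt (1 - (x1 p)\<^sup>2) \<noteq> 0" if "p \<in> Z" for p
    using x1_less_1[OF that] by auto
  have q: "64 * q1 p \<noteq> 0" if "p \<in> Z" for p
    using q1_gt[OF that] by auto
  have b: "C_inf_on Z q0" "C_inf_on Z s0" "C_inf_on Z e0"
    unfolding q0_def[abs_def] s0_def[abs_def] e0_def[abs_def] by (intro h)+
  have c: "C_inf_on Z c0"
    unfolding c0_def[abs_def] by (intro h b) simp
  have v: "C_inf_on Z v0" and N: "C_inf_on Z N"
    unfolding v0_def[abs_def] N_def[abs_def] by (intro h b)+
  have al: "C_inf_on Z \<alpha>"
    unfolding \<alpha>_def[abs_def] by (intro h b c N nz)
  have xy: "C_inf_on Z x1" "C_inf_on Z y1" "C_inf_on Z q1"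
    unfolding x1_def[abs_def] y1_def[abs_def] q1_def[abs_def] by (intro h b N al nz)+
  have v1: "C_inf_on Z v1"
    unfolding v1_def[abs_def] by (rule C_inf_on_add[OF open_Z v]) (intro h N nz)
  show "C_inf_on Z c0" "C_inf_on Z v1" by (fact c v1)+
  show "C_inf_on Z \<rho>"
    unfolding \<rho>_def[abs_def] by (intro h xy C_inf_on_sqrt s) auto
  show "C_inf_on Z \<theta>"
    unfolding \<theta>_def[abs_def] by (intro C_inf_on_disc_area open_Z xy x1_less_1)
  show "C_inf_on Z t1" "C_inf_on Z \<phi>"
    unfolding t1_def[abs_def] \<phi>_def[abs_def] by (intro h xy b q; simp)+
qed

text \<open>Changes inside the \<open>b\<close>- and \<open>c\<close>-planes come first, then the
  rotation coupling all three planes, then the passage to \<open>(\<rho>, \<theta>)\<close> and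
  \<open>(t1, \<phi>)\<close>. Cycling brings the plane concerned to the front.\<close>

lemma frame_base:
  assumes "p \<in> Z"
  shows "symp_frame p \<Omega> \<rho> \<theta> t1 \<phi> c0 v1"
proof -
  have 0: "symp_frame p \<Omega> xb yb xc yc xa ya"
    by (rule symp_frameI) (rule bounded_linear_imp_has_derivative bounded_linear_compose[OF bounded_linear_vec_nth, OF bounded_linear_fst, unfolded o_def]
        bounded_linear_compose[OF bounded_linear_vec_nth, OF bounded_linear_snd, unfolded o_def] | simp add: \<Omega>_def)+
  have "symp_frame p \<Omega> q0 s0 xc yc xa ya"
    unfolding q0_def[abs_def] s0_def[abs_def]
  proof (rule symp_frame_plane[OF 0])
    fix d e assume d: "(xb has_derivative d) (at p)" and e: "(yb has_derivative e) (at p)"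
    note ex = DERIV_compose_FDERIV[OF DERIV_exp d] DERIV_compose_FDERIV[OF DERIV_exp has_derivative_minus[OF d]]
    show "((\<lambda>p. exp (xb p)) has_derivative (\<lambda>u. exp (xb p) * d u + 0 * e u)) (at p)"
      by (rule has_derivative_eq_rhs[OF ex(1)]) auto
    show "((\<lambda>p. yb p * exp (- xb p)) has_derivative (\<lambda>u. (- yb p * exp (- xb p)) * d u + exp (- xb p) * e u)) (at p)"
      by (rule has_derivative_eq_rhs[OF has_derivative_mult[OF e ex(2)]]) (auto simp: algebra_simps)
  qed (simp flip: exp_add)
  from symp_frame_cycle[OF this]
  have "symp_frame p \<Omega> e0 (\<lambda>p. exp (yc p)) xa ya q0 s0"
    unfolding e0_def[abs_def]
  proof (rule symp_frame_plane)
    fix d e assume d: "(xc has_derivative d) (at p)" and e: "(yc has_derivative e) (at p)"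
    note ex = DERIV_compose_FDERIV[OF DERIV_exp e] DERIV_compose_FDERIV[OF DERIV_exp has_derivative_minus[OF e]]
    show "((\<lambda>p. exp (yc p)) has_derivative (\<lambda>u. 0 * d u + exp (yc p) * e u)) (at p)"
      by (rule has_derivative_eq_rhs[OF ex(1)]) auto
    show "((\<lambda>p. xc p * exp (- yc p)) has_derivative (\<lambda>u. exp (- yc p) * d u + (- xc p * exp (- yc p)) * e u)) (at p)"
      by (rule has_derivative_eq_rhs[OF has_derivative_mult[OF d ex(2)]]) (auto simp: algebra_simps)
  qed (simp flip: exp_add)
  then have "symp_frame p \<Omega> c0 v0 xa ya q0 s0"
    unfolding c0_def[abs_def] v0_def[abs_def]
  proof (rule symp_frame_plane)
    have nz: "1 + (e0 p)\<^sup>2 > 0" by (simp add: add_pos_nonneg)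
    show "inverse (1 + (e0 p)\<^sup>2) / 4 * (4 * (1 + (e0 p)\<^sup>2)) - 0 * (8 * e0 p * exp (yc p)) = 1"
      using nz by (simp add: field_simps)
    fix d e assume d: "(e0 has_derivative d) (at p)" and e: "((\<lambda>p. exp (yc p)) has_derivative e) (at p)"
    show "((\<lambda>p. arctan (e0 p) / 4) has_derivative (\<lambda>u. inverse (1 + (e0 p)\<^sup>2) / 4 * d u + 0 * e u)) (at p)"
      using has_derivative_mult_right[OF DERIV_compose_FDERIV[OF DERIV_arctan d], of "1 / 4"]
      by (simp add: mult.commute)
    have "((\<lambda>p. 4 * (1 + (e0 p)\<^sup>2)) has_derivative (\<lambda>u. 8 * e0 p * d u)) (at p)"
      using d by (auto intro!: derivative_eq_intros)
    from has_derivative_mult[OF this e]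
    show "((\<lambda>p. 4 * (1 + (e0 p)\<^sup>2) * exp (yc p)) has_derivative
        (\<lambda>u. 8 * e0 p * exp (yc p) * d u + 4 * (1 + (e0 p)\<^sup>2) * e u)) (at p)"
      by (rule has_derivative_eq_rhs) (auto simp: algebra_simps)
  qed
  from symp_frame_cycle[OF this]
  have "symp_frame p \<Omega> x1 y1 q1 s0 c0 v1"
    using symp_frame_rotate[of p \<Omega> xa ya q0 s0 c0 v0] N_less_1[OF assms]
    by (simp add: x1_def[abs_def] y1_def[abs_def] q1_def[abs_def] v1_def[abs_def] \<alpha>_def[abs_def] N_def[abs_def])
  then have "symp_frame p \<Omega> \<rho> \<theta> q1 s0 c0 v1"
    unfolding \<rho>_def[abs_def] \<theta>_def[abs_def]
  proof (rule symp_frame_plane)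
    define s where "s = sqrt (1 - (x1 p)\<^sup>2)"
    have s: "s > 0" using x1_less_1[OF assms] by (simp add: s_def)
    show "- y1 p * x1 p / (2 * s ^ 3) * 0 - - 1 / (2 * s) * (2 * s) = 1"
      using s by simp
    fix d e assume d: "(x1 has_derivative d) (at p)" and e: "(y1 has_derivative e) (at p)"
    have "((\<lambda>p. 1 - (x1 p)\<^sup>2) has_derivative (\<lambda>u. - 2 * x1 p * d u)) (at p)"
      using d by (auto intro!: derivative_eq_intros)
    from DERIV_compose_FDERIV[OF DERIV_real_sqrt this] x1_less_1[OF assms]
    have s': "((\<lambda>p. sqrt (1 - (x1 p)\<^sup>2)) has_derivative (\<lambda>u. - x1 p / s * d u)) (at p)"
      by (simp add: s_def field_simps)
    have nz: "sqrt (1 - (x1 p)\<^sup>2) \<noteq> 0" using s by (simp add: s_def)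
    have "((\<lambda>p. (1 / 2) * (1 - y1 p / sqrt (1 - (x1 p)\<^sup>2))) has_derivative
      (\<lambda>u. (- y1 p * x1 p / (2 * s ^ 3)) * d u + (- 1 / (2 * s)) * e u)) (at p)"
      by (rule has_derivative_eq_rhs[OF has_derivative_mult_right[OF has_derivative_diff[OF has_derivative_const
              has_derivative_divide'[OF e s' nz]]]])
        (use s in \<open>auto simp: field_simps power3_eq_cube simp flip: s_def\<close>)
    then show "((\<lambda>p. (1 - y1 p / sqrt (1 - (x1 p)\<^sup>2)) / 2) has_derivative
      (\<lambda>u. (- y1 p * x1 p / (2 * s ^ 3)) * d u + (- 1 / (2 * s)) * e u)) (at p)"
      by simp
    show "((\<lambda>p. disc_area (x1 p)) has_derivative (\<lambda>u. 2 * s * d u + 0 * e u)) (at p)"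
      by (rule has_derivative_eq_rhs[OF DERIV_compose_FDERIV[OF DERIV_disc_area d]]) (use x1_less_1[OF assms] in \<open>auto simp: s_def\<close>)
  qed
  from symp_frame_cycle[OF this]
  have "symp_frame p \<Omega> t1 \<phi> c0 v1 \<rho> \<theta>"
    unfolding t1_def[abs_def] \<phi>_def[abs_def]
  proof (rule symp_frame_plane)
    have q: "q1 p > 0" using q1_gt[OF assms] by simp
    show "- 1 / (64 * (q1 p)\<^sup>2) * (- 64 * (q1 p)\<^sup>2) - 0 * (- 128 * q1 p * s0 p) = 1"
      using q by (simp add: field_simps)
    fix d e assume d: "(q1 has_derivative d) (at p)" and e: "(s0 has_derivative e) (at p)"
    show "((\<lambda>p. 1 / (64 * q1 p)) has_derivative (\<lambda>u. - 1 / (64 * (q1 p)\<^sup>2) * d u + 0 * e u)) (at p)"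
      using q d by (auto intro!: derivative_eq_intros simp: field_simps power2_eq_square)
    have "((\<lambda>p. - 64 * (q1 p)\<^sup>2) has_derivative (\<lambda>u. - 128 * q1 p * d u)) (at p)"
      using d by (auto intro!: derivative_eq_intros)
    from has_derivative_mult[OF this e]
    show "((\<lambda>p. - 64 * (q1 p)\<^sup>2 * s0 p) has_derivative (\<lambda>u. (- 128 * q1 p * s0 p) * d u + (- 64 * (q1 p)\<^sup>2) * e u)) (at p)"
      by (rule has_derivative_eq_rhs) (auto simp: algebra_simps)
  qed
  from symp_frame_cycle[OF symp_frame_cycle[OF this]] show ?thesis .
qed

text \<open>The changes are undone from last to first. The rotation preserves \<open>N\<close>, so
  \<open>x1\<close> and \<open>y1\<close> determine \<open>N\<close>, and with it the angle
  \<open>\<alpha>\<close> and the summand \<open>1 / (1 - N p)\<close>.\<close>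

lemma base_inj:
  assumes p: "p \<in> Z" "p' \<in> Z"
    and eq: "\<rho> p = \<rho> p'" "\<theta> p = \<theta> p'" "t1 p = t1 p'" "\<phi> p = \<phi> p'" "c0 p = c0 p'" "v1 p = v1 p'"
  shows "xa p = xa p'" "ya p = ya p'" "xb p = xb p'" "yb p = yb p'" "xc p = xc p'" "yc p = yc p'"
proof -
  have x1: "x1 p = x1 p'"
    using disc_area_inj[OF x1_less_1(1)[OF p(1)] x1_less_1(1)[OF p(2)]] eq(2) by (simp add: \<theta>_def)
  have y1: "y1 p = y1 p'"
    using eq(1) x1 x1_less_1(3)[OF p(1)] by (auto simp: \<rho>_def)
  have q1: "q1 p = q1 p'"
    using eq(3) q1_gt[OF p(1)] q1_gt[OF p(2)] by (simp add: t1_def)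
  have s0: "s0 p = s0 p'"
    using eq(4) q1 q1_gt[OF p(1)] by (auto simp: \<phi>_def)
  have N: "N p = N p'"
    using N_rotate[of p] N_rotate[of p'] x1 y1 by simp
  have \<alpha>: "\<alpha> p = \<alpha> p'"
    using N s0 eq(5) by (simp add: \<alpha>_def)
  have rot: "xa p = cos (\<alpha> p) * x1 p + sin (\<alpha> p) * y1 p" "ya p = cos (\<alpha> p) * y1 p - sin (\<alpha> p) * x1 p" for p
  proof -
    have "cos (\<alpha> p) * x1 p + sin (\<alpha> p) * y1 p = ((cos (\<alpha> p))\<^sup>2 + (sin (\<alpha> p))\<^sup>2) * xa p"
      "cos (\<alpha> p) * y1 p - sin (\<alpha> p) * x1 p = ((cos (\<alpha> p))\<^sup>2 + (sin (\<alpha> p))\<^sup>2) * ya p"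
      unfolding x1_def y1_def by algebra+
    then show "xa p = cos (\<alpha> p) * x1 p + sin (\<alpha> p) * y1 p" "ya p = cos (\<alpha> p) * y1 p - sin (\<alpha> p) * x1 p"
      by simp_all
  qed
  show "xa p = xa p'" "ya p = ya p'"
    using rot[of p] rot[of p'] x1 y1 \<alpha> by simp_all
  show xb: "xb p = xb p'"
    using q1 N by (simp add: q1_def q0_def)
  then show "yb p = yb p'"
    using s0 by (simp add: s0_def)
  have e0: "e0 p = e0 p'"
    using eq(5) by (simp add: c0_def arctan_eq_iff)
  have nz: "1 + (e0 p')\<^sup>2 \<noteq> 0"
    using zero_le_power2[of "e0 p'"] by linarith
  show yc: "yc p = yc p'"
    using eq(6) N e0 nz by (simp add: v1_def v0_def)
  then show "xc p = xc p'"
    using e0 by (simp add: e0_def)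
qed

section \<open>Charts for the turns and the glued map\<close>

definition \<psi> :: "int \<Rightarrow> (real^'n) \<times> (real^'n) \<Rightarrow> real" where "\<psi> m p = \<phi> p - 2 * pi * of_int m"
definition \<Psi> :: "int \<Rightarrow> (real^'n) \<times> (real^'n) \<Rightarrow> real" where "\<Psi> m p = psi2 (\<rho> p) (\<psi> m p) (t1 p) (v1 p)"
definition A2 :: "int \<Rightarrow> (real^'n) \<times> (real^'n) \<Rightarrow> real" where "A2 m p = area2 (\<rho> p) (\<psi> m p) (t1 p) (v1 p)"
definition \<Theta> :: "int \<Rightarrow> (real^'n) \<times> (real^'n) \<Rightarrow> real" where "\<Theta> m p = theta2 (\<rho> p) (\<theta> p) (\<psi> m p) (t1 p) (v1 p)"
text \<open>The term \<open>- of_int m\<close> compensates the jump by one in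
  \<open>chart_overlap\<close>, so that consecutive charts agree.\<close>

definition C2 :: "int \<Rightarrow> (real^'n) \<times> (real^'n) \<Rightarrow> real" where "C2 m p = c2 (\<rho> p) (c0 p) (\<psi> m p) (t1 p) (v1 p) - of_int m"

definition G :: "int \<Rightarrow> (real^'n) \<times> (real^'n) \<Rightarrow> (real^'n) \<times> (real^'n)" where
  "G m p =
    (\<chi> i. if i = a then sqrt (2 * \<rho> p) * cos (\<Theta> m p) else if i = b then sqrt (2 * A2 m p) * cos (\<Psi> m p)
          else if i = c then C2 m p else fst p $ i,
     \<chi> i. if i = a then sqrt (2 * \<rho> p) * sin (\<Theta> m p) else if i = b then sqrt (2 * A2 m p) * sin (\<Psi> m p)
          else if i = c then v1 p else snd p $ i)"

definition turn :: "(real^'n) \<times> (real^'n) \<Rightarrow> int" where "turn p = \<lfloor>(\<phi> p + pi) / (2 * pi)\<rfloor>"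

definition F :: "(real^'n) \<times> (real^'n) \<Rightarrow> (real^'n) \<times> (real^'n)" where "F p = G (turn p) p"

lemma psi_turn: "- pi \<le> \<psi> (turn p) p" "\<psi> (turn p) p < pi"
proof -
  have "of_int (turn p) \<le> (\<phi> p + pi) / (2 * pi)" "(\<phi> p + pi) / (2 * pi) < of_int (turn p) + 1"
    unfolding turn_def by linarith+
  then show "- pi \<le> \<psi> (turn p) p" "\<psi> (turn p) p < pi"
    by (simp_all add: \<psi>_def field_simps)
qed

lemma chart_positive:
  assumes "p \<in> Z"
  shows "0 < \<rho> p" "0 < A2 m p" "\<rho> p + A2 m p < 3 / 2" "v1 p > 1"
  unfolding A2_def
  by (rule admissibleD[OF admissible_base[OF assms]] area2_bounds[OF admissible_base[OF assms]])+

lemma G_overlap: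
  assumes "p \<in> Z" "pi / 2 \<le> \<psi> m p" "\<psi> m p \<le> 3 * pi / 2"
  shows "G m p = G (m + 1) p"
proof -
  have \<psi>: "\<psi> (m + 1) p = \<psi> m p - 2 * pi" by (simp add: \<psi>_def algebra_simps)
  note ov = chart_overlap[OF admissible_base[OF assms(1)] assms(2,3)]
  have eq: "\<Psi> m p = \<Psi> (m + 1) p + 2 * pi" "A2 m p = A2 (m + 1) p" "\<Theta> m p = \<Theta> (m + 1) p" "C2 m p = C2 (m + 1) p"
    by (simp_all add: \<Psi>_def A2_def \<Theta>_def C2_def \<psi> ov)
  show ?thesis
    unfolding G_def eq cos_periodic sin_periodic ..
qed

text \<open>The windows are longer than a turn, so \<open>m\<close> and \<open>turn p\<close> differ
  by at most one, and if they differ the point lies in the range of \<open>G_overlap\<close>. Thus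
  \<open>F\<close> agrees with one smooth chart on an open set around each point, although
  \<open>turn\<close> jumps.\<close>

lemma F_eq_G:
  assumes "p \<in> Z" "\<bar>\<psi> m p\<bar> < 3 * pi / 2"
  shows "F p = G m p"
proof -
  have d: "\<psi> m p - \<psi> (turn p) p = 2 * pi * of_int (turn p - m)"
    by (simp add: \<psi>_def algebra_simps)
  have "2 * pi * \<bar>real_of_int (turn p - m)\<bar> = \<bar>\<psi> m p - \<psi> (turn p) p\<bar>"
    unfolding d by (simp add: abs_mult)
  also have "\<dots> < 2 * pi * 2"
    using assms(2) psi_turn[of p] pi_gt_zero by linarith
  finally have "\<bar>real_of_int (turn p - m)\<bar> < 2" by simp
  then have "turn p = m \<or> turn p = m + 1 \<or> m = turn p + 1" by linarith
  then show ?thesis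
  proof (elim disjE)
    assume t: "turn p = m + 1"
    then have "\<psi> m p = \<psi> (turn p) p + 2 * pi" using d by simp
    then have "pi / 2 \<le> \<psi> m p" "\<psi> m p \<le> 3 * pi / 2"
      using psi_turn[of p] assms(2) pi_gt_zero by linarith+
    from G_overlap[OF assms(1) this] show ?thesis by (simp add: F_def t)
  next
    assume t: "m = turn p + 1"
    then have "\<psi> (turn p) p = \<psi> m p + 2 * pi" using d by simp
    then have "pi / 2 \<le> \<psi> (turn p) p" "\<psi> (turn p) p \<le> 3 * pi / 2"
      using psi_turn[of p] assms(2) pi_gt_zero by linarith+
    from G_overlap[OF assms(1) this] show ?thesis by (simp add: F_def t)
  qed (simp add: F_def)
qed

lemma C_inf_chart:
  "C_inf_on Z (\<psi> m)" "C_inf_on Z (\<Psi> m)" "C_inf_on Z (A2 m)" "C_inf_on Z (\<Theta> m)" "C_inf_on Z (C2 m)"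
proof -
  note h = open_Z C_inf_base C_inf_on_add C_inf_on_diff C_inf_on_const
  show \<psi>: "C_inf_on Z (\<psi> m)" unfolding \<psi>_def[abs_def] by (intro h)
  note bend = C_inf_on_bend[OF open_Z C_inf_base(1) _ C_inf_base(6) chart_positive(4)]
  have t: "C_inf_on Z (\<lambda>p. t1 p - UU (\<rho> p) (\<psi> m p) (v1 p))"
    by (intro h bend \<psi>)
  note tr = C_inf_on_travel[OF open_Z t C_inf_base(6)]
  show \<Psi>: "C_inf_on Z (\<Psi> m)"
    unfolding \<Psi>_def[abs_def] psi2_def by (intro h \<psi> tr)
  note P = \<Psi>[unfolded \<Psi>_def[abs_def]]
  show "C_inf_on Z (A2 m)" unfolding A2_def[abs_def] area2_def by (intro h t bend P)
  show "C_inf_on Z (\<Theta> m)" unfolding \<Theta>_def[abs_def] theta2_def by (intro h \<psi> bend P)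
  show "C_inf_on Z (C2 m)" unfolding C2_def[abs_def] c2_def by (intro h \<psi> bend tr P)
qed

lemma C_inf_G: "C_inf_on Z (G m)"
proof (rule C_inf_on_componentwise[OF open_Z])
  fix e :: "(real^'n) \<times> (real^'n)" assume "e \<in> Basis"
  then obtain i where "e = (axis i 1, 0) \<or> e = (0, axis i 1)"
    by (auto simp: Basis_prod_def Basis_vec_def)
  then have e: "(\<lambda>p. G m p \<bullet> e) = (\<lambda>p. fst (G m p) $ i) \<or> (\<lambda>p. G m p \<bullet> e) = (\<lambda>p. snd (G m p) $ i)"
    by (auto simp: inner_prod_def inner_axis)
  note h = open_Z C_inf_on_mult C_inf_on_sqrt C_inf_on_cos C_inf_on_sin C_inf_on_const C_inf_base C_inf_chart
  have pos: "0 < 2 * \<rho> p" "0 < 2 * A2 m p" if "p \<in> Z" for p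
    using chart_positive[OF that] by auto
  have polar: "C_inf_on Z (\<lambda>p. sqrt (2 * \<rho> p) * cos (\<Theta> m p))" "C_inf_on Z (\<lambda>p. sqrt (2 * A2 m p) * cos (\<Psi> m p))"
    "C_inf_on Z (\<lambda>p. sqrt (2 * \<rho> p) * sin (\<Theta> m p))" "C_inf_on Z (\<lambda>p. sqrt (2 * A2 m p) * sin (\<Psi> m p))"
    by (intro h pos; assumption)+
  have "C_inf_on Z (\<lambda>p. fst (G m p) $ i)" "C_inf_on Z (\<lambda>p. snd (G m p) $ i)"
  proof -
    note G = G_def fst_conv snd_conv vec_lambda_beta
    consider "i = a" | "i \<noteq> a" "i = b" | "i \<noteq> a" "i \<noteq> b" "i = c" | "i \<noteq> a" "i \<noteq> b" "i \<noteq> c" by blast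
    then have "C_inf_on Z (\<lambda>p. fst (G m p) $ i) \<and> C_inf_on Z (\<lambda>p. snd (G m p) $ i)"
      by cases (simp_all only: G polar simp_thms if_True if_False C_inf_on_coord[OF open_Z] C_inf_base(6) C_inf_chart(5))
    then show "C_inf_on Z (\<lambda>p. fst (G m p) $ i)" "C_inf_on Z (\<lambda>p. snd (G m p) $ i)" by auto
  qed
  then show "C_inf_on Z (\<lambda>p. G m p \<bullet> e)" using e by metis
qed

lemma C_inf_F: "C_inf_on Z F"
proof (rule C_inf_on_local)
  fix p assume p: "p \<in> Z"
  let ?U = "{q \<in> Z. \<bar>\<psi> (turn p) q\<bar> < 3 * pi / 2}"
  have "continuous_on Z (\<psi> (turn p))"
    using C_inf_on_differentiable[OF C_inf_chart(1)] has_derivative_continuous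
    by (blast intro: continuous_at_imp_continuous_on)
  then have "open (Z \<inter> (\<lambda>q. \<bar>\<psi> (turn p) q\<bar>) -` {..<3 * pi / 2})"
    by (intro continuous_open_preimage open_Z continuous_intros) auto
  also have "Z \<inter> (\<lambda>q. \<bar>\<psi> (turn p) q\<bar>) -` {..<3 * pi / 2} = ?U" by auto
  finally have "open ?U" .
  then have "C_inf_on ?U F"
    by (rule C_inf_on_cong[OF _ _ C_inf_on_subset[OF C_inf_G]]) (auto simp: F_eq_G)
  moreover have "p \<in> ?U" using p psi_turn[of p] pi_gt_zero by (auto simp: abs_if)
  ultimately show "\<exists>U. p \<in> U \<and> C_inf_on U F" by (intro exI[of _ ?U] conjI)
qed

text \<open>The chain of symplectic steps is: shift the angle, bend back, travel, bend forward,
  translate by \<open>1 / 2\<close> and by \<open>- of_int m\<close>, and pass to polar coordinates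
  in two planes.\<close>

lemma frame_chart:
  assumes "p \<in> Z"
  shows "symp_frame p \<Omega> (\<lambda>p. sqrt (2 * \<rho> p) * cos (\<Theta> m p)) (\<lambda>p. sqrt (2 * \<rho> p) * sin (\<Theta> m p))
    (\<lambda>p. sqrt (2 * A2 m p) * cos (\<Psi> m p)) (\<lambda>p. sqrt (2 * A2 m p) * sin (\<Psi> m p)) (C2 m) v1"
proof -
  note cyc = symp_frame_cycle
  note pos = chart_positive[OF assms]
  from cyc[OF frame_base[OF assms]] have "symp_frame p \<Omega> (\<lambda>p. t1 p + 0) (\<lambda>p. \<phi> p + (- 2 * pi * of_int m)) c0 v1 \<rho> \<theta>"
    by (rule symp_frame_translate)
  then have "symp_frame p \<Omega> t1 (\<psi> m) c0 v1 \<rho> \<theta>" by (simp add: \<psi>_def[abs_def])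
  from symp_frame_bend[OF cyc[OF cyc[OF this]] pos(4), of "- 1"]
  have "symp_frame p \<Omega> \<rho> (\<lambda>p. \<theta> p - tau (\<psi> m p) (v1 p)) (\<lambda>p. t1 p - UU (\<rho> p) (\<psi> m p) (v1 p)) (\<psi> m)
    (\<lambda>p. c0 p - VV (\<rho> p) (\<psi> m p) (v1 p)) v1" by simp
  from symp_frame_bend[OF symp_frame_travel[OF this] pos(4), of 1]
  have "symp_frame p \<Omega> \<rho> (\<Theta> m) (\<lambda>p. t1 p - UU (\<rho> p) (\<psi> m p) (v1 p) + UU (\<rho> p) (\<Psi> m p) (v1 p)) (\<Psi> m)
    (\<lambda>p. c2 (\<rho> p) (c0 p) (\<psi> m p) (t1 p) (v1 p)) v1"
    by (simp add: \<Theta>_def[abs_def] theta2_def \<Psi>_def[abs_def] psi2_def c2_def)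
  from symp_frame_translate[OF cyc[OF this], of "1 / 2" 0]
  have "symp_frame p \<Omega> (A2 m) (\<Psi> m) (\<lambda>p. c2 (\<rho> p) (c0 p) (\<psi> m p) (t1 p) (v1 p)) v1 \<rho> (\<Theta> m)"
    by (simp add: A2_def[abs_def] area2_def \<Psi>_def[abs_def] algebra_simps)
  from symp_frame_translate[OF cyc[OF symp_frame_polar[OF this pos(2)]], of "- of_int m" 0]
  have "symp_frame p \<Omega> (C2 m) v1 \<rho> (\<Theta> m) (\<lambda>p. sqrt (2 * A2 m p) * cos (\<Psi> m p)) (\<lambda>p. sqrt (2 * A2 m p) * sin (\<Psi> m p))"
    by (simp add: C2_def[abs_def])
  from cyc[OF cyc[OF cyc[OF symp_frame_polar[OF cyc[OF this] pos(1)]]]] show ?thesis .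
qed

lemma omega_split:
  "omega u v = (xa u * ya v - xa v * ya u) + (xb u * yb v - xb v * yb u) + (xc u * yc v - xc v * yc u)
     + (\<Sum>i\<in>- {a, b, c}. fst u $ i * snd v $ i - snd u $ i * fst v $ i)"
proof -
  have "omega u v = (\<Sum>i\<in>{a, b, c}. fst u $ i * snd v $ i - snd u $ i * fst v $ i)
     + (\<Sum>i\<in>- {a, b, c}. fst u $ i * snd v $ i - snd u $ i * fst v $ i)"
    unfolding omega_def by (subst sum.subset_diff[of "{a, b, c}"]) (auto simp: Compl_eq_Diff_UNIV)
  then show ?thesis using distinct by (simp add: algebra_simps)
qed

lemma G_symplectic:
  assumes "p \<in> Z"
  shows "\<exists>L. (G m has_derivative L) (at p) \<and> (\<forall>u v. omega (L u) (L v) = omega u v)"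
  using frame_chart[OF assms, of m]
proof (rule symp_frameE)
  fix d1 e1 d2 e2 d3 e3
  assume d: "((\<lambda>p. sqrt (2 * \<rho> p) * cos (\<Theta> m p)) has_derivative d1) (at p)" "((\<lambda>p. sqrt (2 * \<rho> p) * sin (\<Theta> m p)) has_derivative e1) (at p)"
    "((\<lambda>p. sqrt (2 * A2 m p) * cos (\<Psi> m p)) has_derivative d2) (at p)" "((\<lambda>p. sqrt (2 * A2 m p) * sin (\<Psi> m p)) has_derivative e2) (at p)"
    "(C2 m has_derivative d3) (at p)" "(v1 has_derivative e3) (at p)"
    and \<Omega>: "\<And>u v. \<Omega> u v = d1 u * e1 v - d1 v * e1 u + (d2 u * e2 v - d2 v * e2 u) + (d3 u * e3 v - d3 v * e3 u)"
  define L where "L = (\<lambda>u :: (real^'n) \<times> (real^'n).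
    (\<chi> i. if i = a then d1 u else if i = b then d2 u else if i = c then d3 u else fst u $ i,
     \<chi> i. if i = a then e1 u else if i = b then e2 u else if i = c then e3 u else snd u $ i))"
  have lin: "((\<lambda>p :: (real^'n) \<times> (real^'n). fst p $ i) has_derivative (\<lambda>u. fst u $ i)) (at p)"
    "((\<lambda>p :: (real^'n) \<times> (real^'n). snd p $ i) has_derivative (\<lambda>u. snd u $ i)) (at p)" for i
    by (auto intro!: bounded_linear_imp_has_derivative bounded_linear_compose[OF bounded_linear_vec_nth, OF bounded_linear_fst, unfolded o_def]
        bounded_linear_compose[OF bounded_linear_vec_nth, OF bounded_linear_snd, unfolded o_def])
  have "(G m has_derivative L) (at p)"
    unfolding has_derivative_componentwise_within[of "G m"]
  proof
    fix e :: "(real^'n) \<times> (real^'n)" assume "e \<in> Basis"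
    then obtain i where "e = (axis i 1, 0) \<or> e = (0, axis i 1)"
      by (auto simp: Basis_prod_def Basis_vec_def)
    then have e: "(\<lambda>p. G m p \<bullet> e) = (\<lambda>p. fst (G m p) $ i) \<and> (\<lambda>u. L u \<bullet> e) = (\<lambda>u. fst (L u) $ i)
      \<or> (\<lambda>p. G m p \<bullet> e) = (\<lambda>p. snd (G m p) $ i) \<and> (\<lambda>u. L u \<bullet> e) = (\<lambda>u. snd (L u) $ i)"
      by (auto simp: inner_prod_def inner_axis)
    note GL = G_def L_def fst_conv snd_conv vec_lambda_beta
    consider "i = a" | "i \<noteq> a" "i = b" | "i \<noteq> a" "i \<noteq> b" "i = c" | "i \<noteq> a" "i \<noteq> b" "i \<noteq> c" by blast
    then have "((\<lambda>p. fst (G m p) $ i) has_derivative (\<lambda>u. fst (L u) $ i)) (at p) \<and>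
      ((\<lambda>p. snd (G m p) $ i) has_derivative (\<lambda>u. snd (L u) $ i)) (at p)"
      by cases (simp_all only: GL d lin simp_thms if_True if_False)
    then show "((\<lambda>p. G m p \<bullet> e) has_derivative (\<lambda>u. L u \<bullet> e)) (at p)"
      using e by metis
  qed
  moreover have "omega (L u) (L v) = omega u v" for u v
  proof -
    have L: "xa (L u) = d1 u" "ya (L u) = e1 u" "xb (L u) = d2 u" "yb (L u) = e2 u" "xc (L u) = d3 u" "yc (L u) = e3 u" for u
      using distinct by (auto simp: L_def)
    have rest: "(\<Sum>i\<in>- {a, b, c}. fst (L u) $ i * snd (L v) $ i - snd (L u) $ i * fst (L v) $ i)
      = (\<Sum>i\<in>- {a, b, c}. fst u $ i * snd v $ i - snd u $ i * fst v $ i)"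
      by (rule sum.cong) (auto simp: L_def)
    show ?thesis
      unfolding omega_split[of "L u"] omega_split[of u] L rest using \<Omega>[of u v] by (simp add: \<Omega>_def)
  qed
  ultimately show ?thesis by blast
qed

lemma F_symplectic:
  assumes "p \<in> Z"
  shows "\<exists>L. (F has_derivative L) (at p) \<and> (\<forall>u v. omega (L u) (L v) = omega u v)"
proof -
  let ?m = "turn p"
  obtain L where L: "(G ?m has_derivative L) (at p)" "\<forall>u v. omega (L u) (L v) = omega u v"
    using G_symplectic[OF assms] by blast
  have "continuous (at p) (\<psi> ?m)"
    using C_inf_on_differentiable[OF C_inf_chart(1) assms] has_derivative_continuous by blast
  \<comment> \<open>The window condition is open, so \<open>F\<close> and the fixed chart
    \<open>G ?m\<close> agree near \<open>p\<close> and share their derivative.\<close>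
  then have "continuous (at p) (\<lambda>q. \<bar>\<psi> ?m q\<bar>)"
    by (intro continuous_intros)
  moreover have "\<bar>\<psi> ?m p\<bar> < 3 * pi / 2"
    using psi_turn[of p] pi_gt_zero by (auto simp: abs_if)
  ultimately have "\<forall>\<^sub>F q in at p. \<bar>\<psi> ?m q\<bar> < 3 * pi / 2"
    unfolding continuous_within by (rule order_tendstoD)
  moreover have "\<forall>\<^sub>F q in at p. q \<in> Z"
    using open_Z assms eventually_at_topological by blast
  ultimately have "\<forall>\<^sub>F q in at p. G ?m q = F q"
    by eventually_elim (simp add: F_eq_G)
  then have "(F has_derivative L) (at p)"
    using has_derivative_transform_eventually[OF L(1)] by (simp add: F_def)
  then show ?thesis using L(2) by blast
qed

text \<open>The image determines \<open>v1\<close> and \<open>\<rho>\<close>, the common parameters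
  in \<open>chart_inj\<close>. That lemma recovers the turn and the remaining coordinates, and
  \<open>base_inj\<close> recovers the point.\<close>

lemma F_inj: "inj_on F Z"
proof (rule inj_onI)
  fix p p' assume p: "p \<in> Z" "p' \<in> Z" and eq: "F p = F p'"
  let ?m = "turn p" and ?m' = "turn p'"
  have f: "fst (F p) $ i = fst (F p') $ i" "snd (F p) $ i = snd (F p') $ i" for i
    using eq by simp_all
  have v: "v1 p = v1 p'" and c: "C2 ?m p = C2 ?m' p'"
    using f[of c] distinct by (simp_all add: F_def G_def)
  obtain k where \<rho>: "\<rho> p = \<rho> p'" and k: "\<Theta> ?m p = \<Theta> ?m' p' + 2 * pi * of_int k"
    using polar_inj[OF chart_positive(1)[OF p(1)] chart_positive(1)[OF p(2)], of "\<Theta> ?m p" "\<Theta> ?m' p'"] f[of a] distinct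
    by (auto simp: F_def G_def)
  obtain j where A: "A2 ?m p = A2 ?m' p'" and j: "\<Psi> ?m p = \<Psi> ?m' p' + 2 * pi * of_int j"
    using polar_inj[OF chart_positive(2)[OF p(1), of ?m] chart_positive(2)[OF p(2), of ?m'], of "\<Psi> ?m p" "\<Psi> ?m' p'"] f[of b] distinct
    by (auto simp: F_def G_def)
  have "\<theta> p = \<theta> p' \<and> t1 p = t1 p' \<and> \<psi> ?m p = \<psi> ?m' p' \<and> ?m = ?m' \<and> c0 p = c0 p'"
    by (rule chart_inj[where \<rho> = "\<rho> p" and v = "v1 p" and j = j and k = k])
      (use admissible_base[OF p(1)] admissible_base[OF p(2)] psi_turn[of p] psi_turn[of p'] v c \<rho> k A j in
        \<open>simp_all add: \<Psi>_def A2_def \<Theta>_def C2_def\<close>)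
  then have "\<theta> p = \<theta> p'" "t1 p = t1 p'" "\<phi> p = \<phi> p'" "c0 p = c0 p'"
    by (auto simp: \<psi>_def)
  note base = base_inj[OF p \<rho> this v]
  have "fst p $ i = fst p' $ i \<and> snd p $ i = snd p' $ i" for i
  proof (cases "i \<in> {a, b, c}")
    case True
    then show ?thesis using base by auto
  next
    case False
    then show ?thesis using f[of i] by (auto simp: F_def G_def)
  qed
  then show "p = p'" by (simp add: prod_eq_iff vec_eq_iff)
qed

text \<open>Squared radii are twice the actions, so the bound \<open>3 / 2\<close> on the sum of the
  actions becomes the radius \<open>sqrt 3\<close>.\<close>

lemma F_image:
  assumes "R \<ge> sqrt 3"
  shows "F ` Z \<subseteq> ball_prod a b R"
proof
  fix z assume "z \<in> F ` Z"
  then obtain p where p: "p \<in> Z" "z = F p" by blast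
  note pos = chart_positive(1)[OF p(1)] chart_positive(2,3)[OF p(1), of "turn p"]
  have "(sqrt 3)\<^sup>2 \<le> R\<^sup>2" using assms by (intro power_mono) auto
  then have "2 * \<rho> p + 2 * A2 (turn p) p < R\<^sup>2" using pos by simp
  then show "z \<in> ball_prod a b R"
    using polar_norm_square[OF pos(1), of "\<Theta> (turn p) p"] polar_norm_square[OF pos(2), of "\<Psi> (turn p) p"] distinct
    by (simp add: p(2) ball_prod_def case_prod_beta F_def G_def)
qed

end

section \<open>From symplectic maps to symplectic embeddings\<close>

lemma omega_nondegenerate:
  assumes "\<And>v. omega u v = 0"
  shows "u = 0"
proof -
  have "fst u $ i = 0" "snd u $ i = 0" for i
    using assms[of "(0, axis i 1)"] assms[of "(axis i 1, 0)"]
    by (simp_all add: omega_def axis_def if_distrib[of "\<lambda>x. _ * x"] sum_negf cong: if_cong)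
  then show ?thesis by (simp add: prod_eq_iff vec_eq_iff)
qed

text \<open>A linear map preserving the nondegenerate form is injective, and invariance of domain
  makes a continuous injection of an open set a homeomorphism onto its image.\<close>

lemma symplectic_embeddingI:
  assumes "open U" "C_inf_on U f" "inj_on f U" "f ` U \<subseteq> V"
    "\<And>p. p \<in> U \<Longrightarrow> \<exists>L. (f has_derivative L) (at p) \<and> (\<forall>u v. omega (L u) (L v) = omega u v)"
  shows "symplectic_embedding U V f"
proof -
  have cont: "continuous_on U f"
    using C_inf_on_differentiable[OF assms(2)] has_derivative_continuous
    by (blast intro: continuous_at_imp_continuous_on)
  have "\<exists>L. (f has_derivative L) (at p) \<and> inj L" if p: "p \<in> U" for p
  proof -
    obtain L where L: "(f has_derivative L) (at p)" "\<And>u v. omega (L u) (L v) = omega u v"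
      using assms(5)[OF p] by blast
    have lin: "linear L" by (rule has_derivative_linear[OF L(1)])
    have "u = 0" if "L u = 0" for u
    proof (rule omega_nondegenerate)
      show "omega u v = 0" for v
        using L(2)[of u v] that by (simp add: omega_def)
    qed
    then have "inj L" using linear_injective_0[OF lin] by blast
    then show ?thesis using L(1) by blast
  qed
  moreover obtain g where "homeomorphism U (f ` U) f g"
    using invariance_of_domain_homeomorphism[OF assms(1) cont _ assms(3)] by auto
  ultimately show ?thesis
    unfolding symplectic_embedding_def smooth_embedding_def
    using assms C_inf_on_imp_smooth_on[OF assms(2)] by blast
qed

theorem theorem1p2:
  fixes a b :: "'n::finite" and R :: real
  assumes "CARD('n) \<ge> 3" and "a \<noteq> b" and "R \<ge> sqrt 3"
  shows "\<exists>f. symplectic_embedding (cylinder a 1) (ball_prod a b R) f"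
proof -
  \<comment> \<open>Dimension at least three provides the auxiliary plane \<open>c\<close> in which
    the turns are separated.\<close>
  have "card {a, b} \<le> 2" by (simp add: card_insert_if)
  then have "{a, b} \<noteq> UNIV" using assms(1) by auto
  then obtain c where c: "c \<noteq> a" "c \<noteq> b" by blast
  interpret three_planes a b c
    using assms(2) c by unfold_locales auto
  have "symplectic_embedding (cylinder a 1) (ball_prod a b R) F"
    by (rule symplectic_embeddingI[OF open_Z C_inf_F F_inj F_image[OF assms(3)] F_symplectic])
  then show ?thesis by blast
qed

end
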